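(* For any countable discrete group $G$ and generating probability measure $\mu$ on $G$, there exists an action $a\in A_\mu(G,X,\nu)$ whose orbit under the conjugation action of $\mathrm{Aut}(X,\nu)$ is dense in $A_\mu(G,X,\nu)$ with respect to the very weak topology.
   Context: $\mu$ is generating if its support generates $G$ as a semigroup. $(X,\nu)$ is a standard nonatomic Lebesgue probability space; $\mathrm{Aut}^*(X,\nu)$ is the group of invertible nonsingular transformations mod a.e. equality, $\mathrm{Aut}(X,\nu)$ its subgroup of measure-preserving transformations. $U_{T,1}f=\frac{dT_*\nu}{d\nu}\cdot f\circ T^{-1}$. The very weak topology on $\mathrm{Aut}^*(X,\nu)$: $T_n\to T$ iff $\int U_{T_n,1}\mathbf 1_A\mathbf 1_B\,d\nu\to\int U_{T,1}\mathbf 1_A\mathbf 1_B\,d\nu$ for all measurable $A,B$. $A_\mu(G,X,\nu)$ is the set of homomorphisms $a:G\to\mathrm{Aut}^*(X,\nu)$ with $\sum_g\mu(g)a(g)_*\nu=\nu$, with the topology of pointwise convergence. $\mathrm{Aut}(X,\nu)$ acts by $(Ta)(g)=Ta(g)T^{-1}$. *)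

theory Defs
  imports "HOL-Algebra.Group" "HOL-Probability.Probability"
begin

definition std_nonatomic_lebesgue :: "'x measure \<Rightarrow> bool" where
  "std_nonatomic_lebesgue M \<longleftrightarrow> prob_space M \<and>
     (\<exists>f h. f \<in> M \<rightarrow>\<^sub>M restrict_space lborel {0..1::real}
          \<and> h \<in> restrict_space lborel {0..1::real} \<rightarrow>\<^sub>M M
          \<and> distr M (restrict_space lborel {0..1::real}) f = restrict_space lborel {0..1::real}
          \<and> (AE x in M. h (f x) = x)
          \<and> (AE y in restrict_space lborel {0..1::real}. f (h y) = y))"

inductive_set semigroup_generated :: "('g, 'b) monoid_scheme \<Rightarrow> 'g set \<Rightarrow> 'g set"
  for G :: "('g, 'b) monoid_scheme" and S :: "'g set" where
  base: "s \<in> S \<Longrightarrow> s \<in> semigroup_generated G S"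
| mult: "x \<in> semigroup_generated G S \<Longrightarrow> y \<in> semigroup_generated G S
          \<Longrightarrow> x \<otimes>\<^bsub>G\<^esub> y \<in> semigroup_generated G S"

definition nonsingular :: "'x measure \<Rightarrow> ('x \<Rightarrow> 'x) \<Rightarrow> bool" where
  "nonsingular M T \<longleftrightarrow> T \<in> M \<rightarrow>\<^sub>M M \<and>
     (\<forall>A\<in>sets M. (T -` A \<inter> space M \<in> null_sets M) \<longleftrightarrow> A \<in> null_sets M)"

text \<open>(T, S) represents an element of Aut*(X,nu), S being an a.e. inverse of T.\<close>
definition aut_star :: "'x measure \<Rightarrow> ('x \<Rightarrow> 'x) \<Rightarrow> ('x \<Rightarrow> 'x) \<Rightarrow> bool" where
  "aut_star M T S \<longleftrightarrow> nonsingular M T \<and> nonsingular M S \<and>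
     (AE x in M. S (T x) = x) \<and> (AE x in M. T (S x) = x)"

definition aut :: "'x measure \<Rightarrow> ('x \<Rightarrow> 'x) \<Rightarrow> ('x \<Rightarrow> 'x) \<Rightarrow> bool" where
  "aut M T S \<longleftrightarrow> aut_star M T S \<and> distr M M T = M"

definition is_action :: "('g, 'b) monoid_scheme \<Rightarrow> 'x measure \<Rightarrow> ('g \<Rightarrow> 'x \<Rightarrow> 'x) \<Rightarrow> bool" where
  "is_action G M a \<longleftrightarrow> (\<forall>g\<in>carrier G. nonsingular M (a g)) \<and>
     (\<forall>g\<in>carrier G. \<forall>h\<in>carrier G. AE x in M. a (g \<otimes>\<^bsub>G\<^esub> h) x = a g (a h x)) \<and>
     (AE x in M. a \<one>\<^bsub>G\<^esub> x = x)"

definition A_mu :: "('g, 'b) monoid_scheme \<Rightarrow> ('g \<Rightarrow> real) \<Rightarrow> 'x measure \<Rightarrow> ('g \<Rightarrow> 'x \<Rightarrow> 'x) set" where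
  "A_mu G \<mu> M = {a. is_action G M a \<and>
     (\<forall>A\<in>sets M. ((\<lambda>g. \<mu> g * measure (distr M M (a g)) A) has_sum measure M A) (carrier G))}"

text \<open>The functional int U_{T,1} 1_A 1_B d nu, where U_{T,1} f = (dT_* nu / d nu) (f o T^{-1})
  and S is the inverse of T.\<close>
definition vw :: "'x measure \<Rightarrow> ('x \<Rightarrow> 'x) \<Rightarrow> ('x \<Rightarrow> 'x) \<Rightarrow> 'x set \<Rightarrow> 'x set \<Rightarrow> real" where
  "vw M T S A B = (\<integral>x. enn2real (RN_deriv M (distr M M T) x) * indicator A (S x) * indicator B x \<partial>M)"

definition vw_top :: "'x measure \<Rightarrow> (('x \<Rightarrow> 'x) \<times> ('x \<Rightarrow> 'x)) topology" where
  "vw_top M = topology_generated_by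
     {{p. vw M (fst p) (snd p) A B \<in> U} | A B U. A \<in> sets M \<and> B \<in> sets M \<and> open U}"

text \<open>Topology of pointwise convergence on A_mu: a is sent, for each g, to the element
  a(g) of Aut*, represented by the pair (a g, a (g^{-1})).\<close>
definition A_top :: "('g, 'b) monoid_scheme \<Rightarrow> ('g \<Rightarrow> real) \<Rightarrow> 'x measure \<Rightarrow> ('g \<Rightarrow> 'x \<Rightarrow> 'x) topology" where
  "A_top G \<mu> M = subtopology
     (topology_generated_by
        {{a. (a g, a (inv\<^bsub>G\<^esub> g)) \<in> V} | g V. g \<in> carrier G \<and> openin (vw_top M) V})
     (A_mu G \<mu> M)"

definition conj_action :: "('x \<Rightarrow> 'x) \<Rightarrow> ('x \<Rightarrow> 'x) \<Rightarrow> ('g \<Rightarrow> 'x \<Rightarrow> 'x) \<Rightarrow> ('g \<Rightarrow> 'x \<Rightarrow> 'x)" where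
  "conj_action T S a = (\<lambda>g. T \<circ> a g \<circ> S)"

end

theory Submission
  imports Defs
begin

text \<open>The functional defining the very weak topology is the measure of the intersection of \<open>A\<close> with
  the preimage of \<open>B\<close> under \<open>T\<close>, so a stationary action is in the closure of the orbit of \<open>b\<close> as soon as
  its statistics on finitely many sets and group elements are approximated by statistics of \<open>b\<close> on
  sets with the same joint distribution (weak containment): two families of sets with the same joint
  distribution are exchanged by a measure-preserving automorphism.

  Choose a countable family \<open>E j\<close> dense in the measure algebra and a sequence \<open>a n\<close> of stationary
  actions whose statistics on it are dense. Recording the itinerary of a point with respect to all
  \<open>a n\<close> and \<open>E j\<close> gives a measure on the shift over \<open>G\<close> with a \<open>bool\<close>-valued coordinate for each pair
  \<open>(n, j)\<close>; averaging it along the random walk with steps \<open>\<mu>\<close> and passing to a weak limit gives a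
  stationary measure. Since every \<open>a n\<close> is stationary, averaging does not change the marginals, so the
  limit is a stationary joining having each \<open>a n\<close> as a factor, and it is nonatomic. Transported to \<open>M\<close>
  it is the required action. That \<open>\<mu>\<close> generates \<open>G\<close> gives, for each \<open>g\<close>, a bound on the derivative of
  \<open>g\<close> that is uniform over all stationary actions; this makes the limit nonsingular and allows one to
  replace arbitrary sets by members of the family.\<close>

section \<open>Isomorphisms modulo null sets\<close>

definition mod0_iso :: "'a measure \<Rightarrow> 'b measure \<Rightarrow> ('a \<Rightarrow> 'b) \<Rightarrow> ('b \<Rightarrow> 'a) \<Rightarrow> bool" where
  "mod0_iso M N f h \<longleftrightarrow> f \<in> M \<rightarrow>\<^sub>M N \<and> h \<in> N \<rightarrow>\<^sub>M M \<and> distr M N f = N \<and>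
     (AE x in M. h (f x) = x) \<and> (AE y in N. f (h y) = y)"

lemma mod0_isoD:
  assumes "mod0_iso M N f h"
  shows "f \<in> M \<rightarrow>\<^sub>M N" "h \<in> N \<rightarrow>\<^sub>M M" "distr M N f = N"
    "AE x in M. h (f x) = x" "AE y in N. f (h y) = y"
  using assms by (auto simp: mod0_iso_def)

lemma mod0_iso_sym:
  assumes "mod0_iso M N f h"
  shows "mod0_iso N M h f"
proof -
  note [measurable] = mod0_isoD(1,2)[OF assms]
  have "distr N M h = distr (distr M N f) M h"
    by (simp add: mod0_isoD(3)[OF assms])
  also have "\<dots> = distr M M (h \<circ> f)"
    by (rule distr_distr) auto
  also have "\<dots> = distr M M (\<lambda>x. x)"
    by (rule distr_cong_AE) (use mod0_isoD(4)[OF assms] in auto)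
  finally have "distr N M h = M"
    by simp
  with assms show ?thesis
    by (auto simp: mod0_iso_def)
qed

lemma AE_mod0_iso:
  assumes "mod0_iso M N f h" "AE y in N. P y"
  shows "AE x in M. P (f x)"
proof -
  have "AE y in distr M N f. P y"
    using assms(2) by (subst mod0_isoD(3)[OF assms(1)])
  with mod0_isoD(1)[OF assms(1)] show ?thesis
    by (rule AE_distrD)
qed

lemma mod0_iso_trans:
  assumes MN: "mod0_iso M N f h" and NK: "mod0_iso N K f' h'"
  shows "mod0_iso M K (f' \<circ> f) (h \<circ> h')"
  unfolding mod0_iso_def
proof (intro conjI)
  note [measurable] = mod0_isoD(1,2)[OF MN] mod0_isoD(1,2)[OF NK]
  show "f' \<circ> f \<in> M \<rightarrow>\<^sub>M K" "h \<circ> h' \<in> K \<rightarrow>\<^sub>M M"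
    by measurable
  have "distr M K (f' \<circ> f) = distr (distr M N f) K f'"
    by (rule distr_distr[symmetric]) auto
  then show "distr M K (f' \<circ> f) = K"
    by (simp add: mod0_isoD(3)[OF MN] mod0_isoD(3)[OF NK])
  show "AE x in M. (h \<circ> h') ((f' \<circ> f) x) = x"
    using AE_mod0_iso[OF MN mod0_isoD(4)[OF NK]] mod0_isoD(4)[OF MN] by eventually_elim simp
  show "AE y in K. (f' \<circ> f) ((h \<circ> h') y) = y"
    using AE_mod0_iso[OF mod0_iso_sym[OF NK] mod0_isoD(5)[OF MN]] mod0_isoD(5)[OF NK]
    by eventually_elim simp
qed

lemma measure_vimage_mod0_iso:
  assumes "mod0_iso M N f h" "B \<in> sets N"
  shows "measure M (f -` B \<inter> space M) = measure N B"
  using measure_distr[OF mod0_isoD(1)[OF assms(1)] assms(2)] mod0_isoD(3)[OF assms(1)] by simp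

lemma nonsingular_measure_preserving:
  assumes "T \<in> M \<rightarrow>\<^sub>M M" "distr M M T = M"
  shows "nonsingular M T"
proof -
  have "emeasure M (T -` A \<inter> space M) = emeasure M A" if "A \<in> sets M" for A
    using emeasure_distr[OF assms(1) that] assms(2) by simp
  with assms(1) show ?thesis
    by (simp add: nonsingular_def null_sets_def)
qed

lemma aut_mod0_iso: "mod0_iso M M T S \<Longrightarrow> aut M T S"
  using mod0_iso_sym[of M M T S]
  by (auto simp: aut_def aut_star_def mod0_iso_def intro: nonsingular_measure_preserving)

section \<open>Standard nonatomic probability spaces\<close>

abbreviation unit_interval :: "real measure" where
  "unit_interval \<equiv> restrict_space lborel {0..1}"

lemma std_nonatomic_lebesgue_iff_mod0_iso:
  "std_nonatomic_lebesgue M \<longleftrightarrow> prob_space M \<and> (\<exists>f h. mod0_iso M unit_interval f h)"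
  by (simp add: std_nonatomic_lebesgue_def mod0_iso_def)

lemma AE_unit_interval: "AE u in unit_interval. u \<in> {0<..<1}"
  using AE_lborel_singleton[of "0::real"] AE_lborel_singleton[of "1::real"]
  by (auto simp: AE_restrict_space_iff)

definition quantile :: "real measure \<Rightarrow> real \<Rightarrow> real" where
  "quantile R \<omega> = (if \<omega> \<in> {0<..<1} then Inf {x. \<omega> \<le> cdf R x} else 0)"

context real_distribution
begin

lemma quantile_le_iff:
  assumes "\<omega> \<in> {0<..<1}"
  shows "quantile M \<omega> \<le> x \<longleftrightarrow> \<omega> \<le> cdf M x"
proof -
  interpret cdf_distribution M ..
  show ?thesis
    using assms pseudoinverse[of \<omega> x] by (simp add: quantile_def)
qed

lemma measurable_quantile: "quantile M \<in> borel_measurable borel"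
proof -
  interpret cdf_distribution M ..
  show ?thesis
    unfolding quantile_def
    by (rule measurable_If_restrict_space_iff[THEN iffD2])
      (use measurable_CI in \<open>auto simp: greaterThanLessThan_def greaterThan_def lessThan_def
         Collect_conj_eq\<close>)
qed

lemma distr_quantile: "distr unit_interval M (quantile M) = M"
proof (rule measure_eqI)
  interpret cdf_distribution M ..
  let ?U = "restrict_space lborel {0<..<1::real}"
  have q_meas: "quantile M \<in> unit_interval \<rightarrow>\<^sub>M M"
    using measurable_quantile by (simp add: measurable_restrict_space1)
  fix A assume "A \<in> sets (distr unit_interval M (quantile M))"
  then have A: "A \<in> sets borel"
    by simp
  have I_meas: "I \<in> ?U \<rightarrow>\<^sub>M borel"
    using measurable_CI by (simp cong: measurable_cong_sets restrict_space_sets_cong)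
  have "emeasure (distr unit_interval M (quantile M)) A = emeasure lborel (quantile M -` A \<inter> {0..1})"
    using q_meas A by (simp add: emeasure_distr emeasure_restrict_space space_restrict_space)
  also have "\<dots> = emeasure lborel (I -` A \<inter> {0<..<1})"
  proof (rule emeasure_eq_AE)
    show "AE u in lborel. u \<in> quantile M -` A \<inter> {0..1} \<longleftrightarrow> u \<in> I -` A \<inter> {0<..<1}"
      using AE_lborel_singleton[of 0] AE_lborel_singleton[of 1]
      by eventually_elim (auto simp: quantile_def)
    show "quantile M -` A \<inter> {0..1} \<in> sets lborel"
      using measurable_sets[OF measurable_quantile A] by simp
    show "I -` A \<inter> {0<..<1} \<in> sets lborel"
      using measurable_sets[OF I_meas A] by (simp add: sets_restrict_space_iff space_restrict_space)
  qed
  also have "\<dots> = emeasure (distr ?U borel I) A"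
    using I_meas A by (simp add: emeasure_distr emeasure_restrict_space space_restrict_space)
  finally show "emeasure (distr unit_interval M (quantile M)) A = emeasure M A"
    by (simp add: distr_I_eq_M)
qed simp

lemma cdf_quantile:
  assumes nonatomic: "\<And>t. measure M {t} = 0" and \<omega>: "\<omega> \<in> {0<..<1}"
  shows "cdf M (quantile M \<omega>) = \<omega>"
proof (rule antisym)
  let ?q = "quantile M \<omega>"
  have "(cdf M \<longlongrightarrow> cdf M ?q) (at_left ?q)"
    using isCont_cdf nonatomic by (simp add: isCont_def filterlim_at_split)
  moreover have "cdf M x \<le> \<omega>" if "x < ?q" for x
    using quantile_le_iff[OF \<omega>, of x] that by linarith
  then have "\<forall>\<^sub>F x in at_left ?q. cdf M x \<le> \<omega>"
    by (auto simp: eventually_at_filter)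
  ultimately show "cdf M ?q \<le> \<omega>"
    by (rule tendsto_upperbound) simp
  show "\<omega> \<le> cdf M ?q"
    using quantile_le_iff[OF \<omega>] by blast
qed

lemma mod0_iso_cdf_quantile:
  assumes "\<And>t. measure M {t} = 0"
  shows "mod0_iso M unit_interval (cdf M) (quantile M)"
proof -
  interpret cdf_distribution M ..
  have [measurable]: "quantile M \<in> borel_measurable borel"
    by (rule measurable_quantile)
  have [measurable]: "quantile M \<in> unit_interval \<rightarrow>\<^sub>M M"
    using measurable_quantile by (simp add: measurable_restrict_space1)
  have [measurable]: "cdf M \<in> M \<rightarrow>\<^sub>M unit_interval"
    using cdf_nonneg cdf_bounded_prob by (intro measurable_restrict_space2) auto
  have cdf_q: "AE u in unit_interval. cdf M (quantile M u) = u"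
    using AE_unit_interval by eventually_elim (rule cdf_quantile[OF assms])
  then have "AE u in unit_interval. quantile M (cdf M (quantile M u)) = quantile M u"
    by eventually_elim simp
  then have "AE x in distr unit_interval M (quantile M). quantile M (cdf M x) = x"
    by (subst AE_distr_iff) auto
  then have "AE x in M. quantile M (cdf M x) = x"
    unfolding distr_quantile .
  with cdf_q have "mod0_iso unit_interval M (quantile M) (cdf M)"
    by (simp add: mod0_iso_def distr_quantile)
  then show ?thesis
    by (rule mod0_iso_sym)
qed

end

lemma mod0_iso_unit_interval_of_coding:
  fixes e :: "'a \<Rightarrow> real"
  assumes "prob_space N" and [measurable]: "e \<in> borel_measurable N" "d \<in> borel \<rightarrow>\<^sub>M N"
    and decode: "AE y in N. d (e y) = y"
    and fibres: "\<And>t. measure N (e -` {t} \<inter> space N) = 0"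
  shows "mod0_iso N unit_interval (cdf (distr N borel e) \<circ> e) (d \<circ> quantile (distr N borel e))"
    and "AE y in N. quantile (distr N borel e) (cdf (distr N borel e) (e y)) = e y"
proof -
  interpret prob_space N by fact
  let ?R = "distr N borel e"
  interpret R: real_distribution ?R
    by (rule real_distribution_distr) simp
  have "AE t in ?R. e (d t) = t"
    by (subst AE_distr_iff) (use decode in auto)
  moreover have "distr N ?R e = ?R"
    by (rule distr_cong) auto
  ultimately have N_R: "mod0_iso N ?R e d"
    using decode by (auto simp: mod0_iso_def)
  have R_unit: "mod0_iso ?R unit_interval (cdf ?R) (quantile ?R)"
    by (rule R.mod0_iso_cdf_quantile) (simp add: measure_distr fibres)
  show "mod0_iso N unit_interval (cdf ?R \<circ> e) (d \<circ> quantile ?R)"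
    by (rule mod0_iso_trans[OF N_R R_unit])
  show "AE y in N. quantile ?R (cdf ?R (e y)) = e y"
    by (rule AE_mod0_iso[OF N_R mod0_isoD(4)[OF R_unit]])
qed

lemma std_nonatomic_lebesgueI:
  fixes e :: "'a \<Rightarrow> real"
  assumes "prob_space N" "e \<in> borel_measurable N" "d \<in> borel \<rightarrow>\<^sub>M N"
    "AE y in N. d (e y) = y" "\<And>t. measure N (e -` {t} \<inter> space N) = 0"
  shows "std_nonatomic_lebesgue N"
  using mod0_iso_unit_interval_of_coding(1)[OF assms] assms(1)
  by (auto simp: std_nonatomic_lebesgue_iff_mod0_iso)

lemma std_nonatomic_lebesgue_coding:
  assumes "std_nonatomic_lebesgue M"
  obtains e :: "'a \<Rightarrow> real" and d where "e \<in> borel_measurable M" "d \<in> borel \<rightarrow>\<^sub>M M"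
    "AE x in M. d (e x) = x" "\<And>t. measure M (e -` {t} \<inter> space M) = 0"
    "\<And>x. x \<in> space M \<Longrightarrow> e x \<in> {0..1}"
proof -
  obtain f h where iso: "mod0_iso M unit_interval f h"
    using assms by (auto simp: std_nonatomic_lebesgue_iff_mod0_iso)
  have f_range: "f x \<in> {0..1}" if "x \<in> space M" for x
    using measurable_space[OF mod0_isoD(1)[OF iso] that] by (simp add: space_restrict_space)
  define d where "d t = h (max 0 (min 1 t))" for t
  show thesis
  proof (rule that)
    show "f \<in> borel_measurable M"
      using mod0_isoD(1)[OF iso] by (simp add: measurable_restrict_space2_iff)
    have "(\<lambda>t. max 0 (min 1 t)) \<in> borel \<rightarrow>\<^sub>M unit_interval"
      by (rule measurable_restrict_space2) auto
    then show "d \<in> borel \<rightarrow>\<^sub>M M"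
      unfolding d_def using mod0_isoD(2)[OF iso] by (rule measurable_compose)
    show "AE x in M. d (f x) = x"
      using mod0_isoD(4)[OF iso] AE_space by eventually_elim (use f_range in \<open>simp add: d_def\<close>)
    show "measure M (f -` {t} \<inter> space M) = 0" for t
    proof -
      have "f -` {t} \<inter> space M = f -` ({t} \<inter> {0..1}) \<inter> space M"
        using f_range by auto
      also have "measure M \<dots> = measure unit_interval ({t} \<inter> {0..1})"
        by (rule measure_vimage_mod0_iso[OF iso]) (auto simp: sets_restrict_space_iff)
      also have "\<dots> = 0"
        by (subst measure_restrict_space) (auto simp: measure_def emeasure_lborel_countable)
      finally show ?thesis .
    qed
  qed (rule f_range)
qed

text \<open>Code \<open>x\<close> by \<open>p x - e x / 2\<close> with \<open>e x\<close> in the unit interval, so that \<open>p x\<close> is the ceiling of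
  the code.\<close>

lemma std_nonatomic_lebesgue_monotone_coding:
  fixes p :: "'a \<Rightarrow> nat"
  assumes "std_nonatomic_lebesgue M" and [measurable]: "p \<in> M \<rightarrow>\<^sub>M count_space UNIV"
  obtains c :: "'a \<Rightarrow> real" and b where "c \<in> borel_measurable M" "b \<in> borel \<rightarrow>\<^sub>M M"
    "AE x in M. b (c x) = x" "\<And>t. measure M (c -` {t} \<inter> space M) = 0"
    "\<And>x n. x \<in> space M \<Longrightarrow> c x \<le> real n \<longleftrightarrow> p x \<le> n"
proof -
  interpret prob_space M
    using assms(1) by (simp add: std_nonatomic_lebesgue_def)
  obtain e :: "'a \<Rightarrow> real" and d where [measurable]: "e \<in> borel_measurable M" "d \<in> borel \<rightarrow>\<^sub>M M"
    and decode: "AE x in M. d (e x) = x" and fibres: "\<And>t. measure M (e -` {t} \<inter> space M) = 0"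
    and e_range: "\<And>x. x \<in> space M \<Longrightarrow> e x \<in> {0..1}"
    by (rule std_nonatomic_lebesgue_coding[OF assms(1)]) blast
  define c where "c x = real (p x) - e x / 2" for x
  define b where "b t = d (2 * (of_int \<lceil>t\<rceil> - t))" for t :: real
  have ceiling_c: "\<lceil>c x\<rceil> = int (p x)" if "x \<in> space M" for x
    using e_range[OF that] by (auto simp: c_def ceiling_eq_iff)
  then have e_eq: "e x = 2 * (of_int \<lceil>c x\<rceil> - c x)" if "x \<in> space M" for x
    using that by (simp add: c_def)
  show thesis
  proof (rule that)
    show [measurable]: "c \<in> borel_measurable M" and "b \<in> borel \<rightarrow>\<^sub>M M"
      unfolding c_def b_def by measurable
    show "AE x in M. b (c x) = x"
      using decode AE_space by eventually_elim (simp only: b_def e_eq[symmetric])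
    show "measure M (c -` {t} \<inter> space M) = 0" for t
    proof -
      have "measure M (c -` {t} \<inter> space M) \<le> measure M (e -` {2 * (of_int \<lceil>t\<rceil> - t)} \<inter> space M)"
        by (rule finite_measure_mono) (auto simp: e_eq)
      then show ?thesis
        by (simp add: fibres measure_le_0_iff)
    qed
    show "c x \<le> real n \<longleftrightarrow> p x \<le> n" if "x \<in> space M" for x n
      using ceiling_c[OF that] by (metis ceiling_le_iff of_int_of_nat_eq of_nat_le_iff)
  qed
qed

lemma exists_monotone_uniformization:
  fixes p :: "'a \<Rightarrow> nat"
  assumes "std_nonatomic_lebesgue M" "p \<in> M \<rightarrow>\<^sub>M count_space UNIV"
  obtains U V where "mod0_iso M unit_interval U V"
    "AE x in M. \<forall>n. p x \<le> n \<longleftrightarrow> U x \<le> measure M {x \<in> space M. p x \<le> n}"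
proof -
  interpret prob_space M
    using assms(1) by (simp add: std_nonatomic_lebesgue_def)
  obtain c :: "'a \<Rightarrow> real" and b where c: "c \<in> borel_measurable M" and b: "b \<in> borel \<rightarrow>\<^sub>M M"
    and decode: "AE x in M. b (c x) = x" and fibres: "\<And>t. measure M (c -` {t} \<inter> space M) = 0"
    and c_le_iff: "\<And>x n. x \<in> space M \<Longrightarrow> c x \<le> real n \<longleftrightarrow> p x \<le> n"
    by (rule std_nonatomic_lebesgue_monotone_coding[OF assms]) blast
  define R where "R = distr M borel c"
  interpret R: real_distribution R
    unfolding R_def by (rule real_distribution_distr[OF c])
  note uniformization = mod0_iso_unit_interval_of_coding[OF prob_space_axioms c b decode fibres, folded R_def]
  have cdf_R: "cdf R (real n) = measure M {x \<in> space M. p x \<le> n}" for n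
  proof -
    have "c -` {..real n} \<inter> space M = {x \<in> space M. p x \<le> n}"
      using c_le_iff by auto
    then show ?thesis
      using c by (simp add: cdf_def R_def measure_distr)
  qed
  have "AE x in M. \<forall>n. p x \<le> n \<longleftrightarrow> (cdf R \<circ> c) x \<le> measure M {x \<in> space M. p x \<le> n}"
    using uniformization(2) AE_mod0_iso[OF uniformization(1) AE_unit_interval] AE_space
  proof eventually_elim
    case (elim x)
    then show ?case
      using R.quantile_le_iff[of "cdf R (c x)"] by (simp flip: cdf_R c_le_iff)
  qed
  with uniformization(1) show thesis
    by (rule that)
qed

lemma exists_mod0_iso_matching:
  fixes p :: "'a \<Rightarrow> 'c::countable" and q :: "'b \<Rightarrow> 'c"
  assumes "std_nonatomic_lebesgue M" "std_nonatomic_lebesgue N"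
    and [measurable]: "p \<in> M \<rightarrow>\<^sub>M count_space UNIV" "q \<in> N \<rightarrow>\<^sub>M count_space UNIV"
    and distr_eq: "distr M (count_space UNIV) p = distr N (count_space UNIV) q"
  obtains T S where "mod0_iso M N T S" "AE x in M. q (T x) = p x"
proof -
  have [measurable]: "(\<lambda>x. to_nat (p x)) \<in> M \<rightarrow>\<^sub>M count_space UNIV"
    "(\<lambda>y. to_nat (q y)) \<in> N \<rightarrow>\<^sub>M count_space UNIV"
    by measurable
  define F where "F n = measure (distr M (count_space UNIV) p) {c. to_nat c \<le> n}" for n
  have F_p: "measure M {x \<in> space M. to_nat (p x) \<le> n} = F n" for n
    by (simp add: F_def measure_distr vimage_def Int_def conj_commute)
  have F_q: "measure N {y \<in> space N. to_nat (q y) \<le> n} = F n" for n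
    by (simp add: F_def distr_eq measure_distr vimage_def Int_def conj_commute)
  obtain U V where UV: "mod0_iso M unit_interval U V"
    and U: "AE x in M. \<forall>n. to_nat (p x) \<le> n \<longleftrightarrow> U x \<le> F n"
    by (rule exists_monotone_uniformization[OF assms(1), of "\<lambda>x. to_nat (p x)"]) (auto simp: F_p)
  obtain U' V' where UV': "mod0_iso N unit_interval U' V'"
    and U': "AE y in N. \<forall>n. to_nat (q y) \<le> n \<longleftrightarrow> U' y \<le> F n"
    by (rule exists_monotone_uniformization[OF assms(2), of "\<lambda>y. to_nat (q y)"]) (auto simp: F_q)
  have iso: "mod0_iso M N (V' \<circ> U) (V \<circ> U')"
    by (rule mod0_iso_trans[OF UV mod0_iso_sym[OF UV']])
  have "AE x in M. U' (V' (U x)) = U x"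
    by (rule AE_mod0_iso[OF UV mod0_isoD(5)[OF UV']])
  with U AE_mod0_iso[OF iso U'] have "AE x in M. q ((V' \<circ> U) x) = p x"
  proof eventually_elim
    case (elim x)
    then have "to_nat (q ((V' \<circ> U) x)) \<le> n \<longleftrightarrow> to_nat (p x) \<le> n" for n
      by simp
    then show ?case
      by (metis antisym order_refl from_nat_to_nat)
  qed
  with iso show thesis
    by (rule that)
qed

section \<open>Cantor coding\<close>

definition cantor :: "(nat \<Rightarrow> bool) \<Rightarrow> real" where
  "cantor b = (\<Sum>i. 2 * of_bool (b i) / 3 ^ Suc i)"

text \<open>The digits of points of the Cantor set, extended to continuous functions on the whole line
  so that they can be tested against weakly convergent sequences of measures.\<close>

fun cantor_digit :: "nat \<Rightarrow> real \<Rightarrow> real" where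
  "cantor_digit 0 t = max 0 (min 1 (3 * t - 1))"
| "cantor_digit (Suc i) t = cantor_digit i (3 * t - 2 * cantor_digit 0 t)"

lemma summable_cantor: "summable (\<lambda>i. 2 * of_bool (b i) / 3 ^ Suc i :: real)"
proof (rule summable_comparison_test')
  show "summable (\<lambda>i. 2 / 3 * (1 / 3) ^ i :: real)"
    by (intro summable_mult summable_geometric) simp
  show "norm (2 * of_bool (b i) / 3 ^ Suc i :: real) \<le> 2 / 3 * (1 / 3) ^ i" for i
    by (simp add: power_divide)
qed

lemma cantor_bounds: "cantor b \<in> {0..1}"
proof -
  have geometric: "(\<lambda>i. 2 / 3 * (1 / 3) ^ i :: real) sums (2 / 3 * (1 / (1 - 1 / 3)))"
    by (intro sums_mult geometric_sums) simp
  have "cantor b \<le> (\<Sum>i. 2 / 3 * (1 / 3) ^ i)"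
    unfolding cantor_def
    by (intro suminf_le summable_cantor sums_summable[OF geometric]) (simp add: power_divide)
  also have "\<dots> = 1"
    using sums_unique[OF geometric] by simp
  finally show ?thesis
    using suminf_nonneg[OF summable_cantor[of b]] by (simp add: cantor_def)
qed

lemma cantor_rec: "cantor b = (2 * of_bool (b 0) + cantor (\<lambda>i. b (Suc i))) / 3"
proof -
  have "cantor (\<lambda>i. b (Suc i)) / 3 = (\<Sum>i. 2 * of_bool (b (Suc i)) / 3 ^ Suc i / 3)"
    unfolding cantor_def by (rule suminf_divide[symmetric, OF summable_cantor])
  also have "\<dots> = (\<Sum>i. 2 * of_bool (b (Suc i)) / 3 ^ Suc (Suc i))"
    by (simp add: field_simps)
  also have "\<dots> = cantor b - 2 * of_bool (b 0) / 3"
    unfolding cantor_def using suminf_split_head[OF summable_cantor[of b]] by simp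
  finally show ?thesis
    by (simp add: field_simps)
qed

lemma cantor_digit_cantor: "cantor_digit i (cantor b) = of_bool (b i)"
proof (induction i arbitrary: b)
  case 0
  show ?case
    using cantor_bounds[of "\<lambda>i. b (Suc i)"] cantor_rec[of b] by auto
next
  case (Suc i)
  have "cantor_digit 0 (cantor b) = of_bool (b 0)"
    using cantor_bounds[of "\<lambda>i. b (Suc i)"] cantor_rec[of b] by auto
  then have "3 * cantor b - 2 * cantor_digit 0 (cantor b) = cantor (\<lambda>i. b (Suc i))"
    using cantor_rec[of b] by (simp only:) (simp add: field_simps)
  then show ?case
    using Suc.IH[of "\<lambda>i. b (Suc i)"] by (simp only: cantor_digit.simps(2))
qed

lemma continuous_on_cantor_digit [continuous_intros]:
  assumes "continuous_on S f"
  shows "continuous_on S (\<lambda>x. cantor_digit i (f x))"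
  using assms
proof (induction i arbitrary: f)
  case 0
  then show ?case
    by (auto intro!: continuous_intros)
next
  case (Suc i)
  have "continuous_on S (\<lambda>x. 3 * f x - 2 * max 0 (min 1 (3 * f x - 1)))"
    by (intro continuous_intros Suc.prems)
  from Suc.IH[OF this] show ?case
    by simp
qed

lemma cantor_digit_bounds: "cantor_digit i t \<in> {0..1}"
  by (induction i arbitrary: t) auto

lemma borel_measurable_cantor_digit [measurable]: "cantor_digit i \<in> borel_measurable borel"
  by (rule borel_measurable_continuous_onI) (intro continuous_on_cantor_digit continuous_on_id)

section \<open>Probability measures on spaces of 0-1 configurations\<close>

abbreviation bool_PiM :: "'i set \<Rightarrow> ('i \<Rightarrow> bool) measure" where
  "bool_PiM I \<equiv> PiM I (\<lambda>_. count_space UNIV)"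

text \<open>Coordinates outside \<open>I\<close> are constant on the space, hence measurable as well.\<close>

lemma measurable_bool_PiM_coordinate [measurable]: "(\<lambda>x. x i) \<in> bool_PiM I \<rightarrow>\<^sub>M count_space UNIV"
proof (cases "i \<in> I")
  case False
  then show ?thesis
    by (subst measurable_cong[where g="\<lambda>_. undefined"]) (auto simp: space_PiM)
qed (rule measurable_component_singleton)

definition cylinder :: "'i set \<Rightarrow> 'i set \<Rightarrow> ('i \<Rightarrow> bool) set" where
  "cylinder I J = {x \<in> space (bool_PiM I). \<forall>i\<in>J. x i}"

lemma mem_cylinder_iff: "x \<in> cylinder I J \<longleftrightarrow> x \<in> space (bool_PiM I) \<and> (\<forall>i\<in>J. x i)"
  by (simp add: cylinder_def)

lemma sets_cylinder [measurable]:
  assumes "finite J"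
  shows "cylinder I J \<in> sets (bool_PiM I)"
  unfolding cylinder_def using assms by measurable

definition tendsto_on_cylinders ::
  "'i set \<Rightarrow> (nat \<Rightarrow> ('i \<Rightarrow> bool) measure) \<Rightarrow> ('i \<Rightarrow> bool) measure \<Rightarrow> bool" where
  "tendsto_on_cylinders I L \<Lambda> \<longleftrightarrow> (\<forall>J. finite J \<longrightarrow> J \<subseteq> I \<longrightarrow>
     (\<lambda>n. measure (L n) (cylinder I J)) \<longlonglongrightarrow> measure \<Lambda> (cylinder I J))"

lemma tendsto_on_cylindersD:
  assumes "tendsto_on_cylinders I L \<Lambda>" "finite J" "J \<subseteq> I"
  shows "(\<lambda>n. measure (L n) (cylinder I J)) \<longlonglongrightarrow> measure \<Lambda> (cylinder I J)"
  using assms by (simp add: tendsto_on_cylinders_def)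

lemma sets_bool_PiM_eq_sigma_cylinders:
  "sets (bool_PiM I) = sigma_sets (space (bool_PiM I)) {cylinder I J | J. finite J \<and> J \<subseteq> I}"
  (is "_ = sigma_sets ?\<Omega> ?C")
proof (rule antisym)
  have coordinate: "{x \<in> ?\<Omega>. x i \<in> A} \<in> sigma_sets ?\<Omega> ?C" if "i \<in> I" for i A
  proof -
    have pos: "{x \<in> ?\<Omega>. x i} \<in> sigma_sets ?\<Omega> ?C"
      using that by (intro sigma_sets.Basic) (auto simp: cylinder_def intro!: exI[of _ "{i}"])
    have "{x \<in> ?\<Omega>. \<not> x i} = ?\<Omega> - {x \<in> ?\<Omega>. x i}"
      by auto
    with sigma_sets.Compl[OF pos] have neg: "{x \<in> ?\<Omega>. \<not> x i} \<in> sigma_sets ?\<Omega> ?C"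
      by simp
    consider "A = {}" | "A = {True}" | "A = {False}" | "A = UNIV"
      using subset_UNIV[of A] unfolding UNIV_bool by blast
    then show ?thesis
      using pos neg by cases (simp_all add: sigma_sets.Empty sigma_sets_top)
  qed
  have "{{x \<in> ?\<Omega>. x i \<in> A} | i A. i \<in> I \<and> A \<in> sets (count_space UNIV)} \<subseteq> sigma_sets ?\<Omega> ?C"
    using coordinate by auto
  then have "sigma_sets ?\<Omega> {{x \<in> ?\<Omega>. x i \<in> A} | i A. i \<in> I \<and> A \<in> sets (count_space UNIV)} \<subseteq> sigma_sets ?\<Omega> ?C"
    by (rule sigma_sets_mono)
  then show "sets (bool_PiM I) \<subseteq> sigma_sets ?\<Omega> ?C"
    by (simp add: sets_PiM_single space_PiM)
  show "sigma_sets ?\<Omega> ?C \<subseteq> sets (bool_PiM I)"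
    by (rule sets.sigma_sets_subset) auto
qed

lemma bool_PiM_measure_eqI:
  assumes "finite_measure P" "finite_measure Q" "sets P = sets (bool_PiM I)" "sets Q = sets (bool_PiM I)"
    and eq: "\<And>J. finite J \<Longrightarrow> J \<subseteq> I \<Longrightarrow> measure P (cylinder I J) = measure Q (cylinder I J)"
  shows "P = Q"
proof (rule measure_eqI_generator_eq)
  interpret P: finite_measure P by fact
  interpret Q: finite_measure Q by fact
  let ?C = "{cylinder I J | J. finite J \<and> J \<subseteq> I}"
  show "Int_stable ?C"
  proof (rule Int_stableI)
    fix A B assume "A \<in> ?C" "B \<in> ?C"
    then obtain J K where "A = cylinder I J" "B = cylinder I K" "finite (J \<union> K)" "J \<union> K \<subseteq> I"
      by auto
    moreover from this have "A \<inter> B = cylinder I (J \<union> K)"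
      by (auto simp: cylinder_def)
    ultimately show "A \<inter> B \<in> ?C"
      by blast
  qed
  show "?C \<subseteq> Pow (space (bool_PiM I))"
    by (auto simp: cylinder_def)
  show "emeasure P X = emeasure Q X" if "X \<in> ?C" for X
    using that eq by (auto simp: P.emeasure_eq_measure Q.emeasure_eq_measure)
  show "sets P = sigma_sets (space (bool_PiM I)) ?C" "sets Q = sigma_sets (space (bool_PiM I)) ?C"
    by (simp_all add: assms(3,4) sets_bool_PiM_eq_sigma_cylinders)
  show "range (\<lambda>_ :: nat. cylinder I {}) \<subseteq> ?C" "(\<Union>i :: nat. cylinder I {}) = space (bool_PiM I)"
    by (auto simp: cylinder_def)
  show "emeasure P (cylinder I {}) \<noteq> \<infinity>"
    by simp
qed

definition cantor_code :: "'i set \<Rightarrow> ('i \<Rightarrow> bool) \<Rightarrow> real" where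
  "cantor_code I x = cantor (\<lambda>k. k \<in> to_nat_on I ` I \<and> x (from_nat_into I k))"

definition cantor_decode :: "'i set \<Rightarrow> real \<Rightarrow> 'i \<Rightarrow> bool" where
  "cantor_decode I t = (\<lambda>i\<in>I. cantor_digit (to_nat_on I i) t = 1)"

lemma cantor_digit_code:
  assumes "countable I" "i \<in> I"
  shows "cantor_digit (to_nat_on I i) (cantor_code I x) = of_bool (x i)"
  using assms by (simp add: cantor_code_def cantor_digit_cantor)

lemma cantor_decode_code:
  assumes "countable I" "x \<in> space (bool_PiM I)"
  shows "cantor_decode I (cantor_code I x) = x"
  using assms
  by (auto simp: cantor_decode_def cantor_digit_code space_PiM PiE_def extensional_def restrict_def)

lemma measurable_cantor_decode [measurable]: "cantor_decode I \<in> borel \<rightarrow>\<^sub>M bool_PiM I"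
  unfolding cantor_decode_def by (rule measurable_restrict) measurable

lemma measurable_cantor_code [measurable]: "cantor_code I \<in> borel_measurable (bool_PiM I)"
  unfolding cantor_code_def cantor_def by measurable

lemma std_nonatomic_lebesgue_bool_PiM:
  assumes "countable I" "prob_space P" and sets_P [measurable_cong]: "sets P = sets (bool_PiM I)"
    and nonatomic: "\<And>x. x \<in> space (bool_PiM I) \<Longrightarrow> measure P {x} = 0"
  shows "std_nonatomic_lebesgue P"
proof (rule std_nonatomic_lebesgueI)
  note space_P = sets_eq_imp_space_eq[OF sets_P]
  show "AE x in P. cantor_decode I (cantor_code I x) = x"
    using cantor_decode_code[OF assms(1)] by (auto simp: space_P intro!: AE_I2)
  show "measure P (cantor_code I -` {t} \<inter> space P) = 0" for t
  proof (cases "cantor_code I -` {t} \<inter> space P = {}")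
    case False
    then obtain x where x: "x \<in> space P" "cantor_code I x = t"
      by auto
    have "y = x" if "y \<in> space P" "cantor_code I y = t" for y
      using that x cantor_decode_code[OF assms(1)] space_P by metis
    with x have "cantor_code I -` {t} \<inter> space P = {x}"
      by blast
    with x show ?thesis
      using nonatomic by (simp add: space_P)
  qed simp
qed (use assms(2) in measurable)

definition digit_product :: "'i set \<Rightarrow> 'i set \<Rightarrow> real \<Rightarrow> real" where
  "digit_product I J t = (\<Prod>i\<in>J. cantor_digit (to_nat_on I i) t)"

lemma continuous_on_digit_product: "continuous_on UNIV (digit_product I J)"
  unfolding digit_product_def by (intro continuous_intros)

lemma digit_product_bounds: "digit_product I J t \<in> {0..1}"
  using cantor_digit_bounds[of _ t] by (auto simp: digit_product_def intro!: prod_nonneg prod_le_1)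

lemma measure_distr_cantor_decode_cylinder:
  assumes "real_distribution R" and J: "finite J" "J \<subseteq> I"
    and digits: "\<And>i. i \<in> I \<Longrightarrow> AE t in R. cantor_digit (to_nat_on I i) t \<in> {0, 1}"
  shows "measure (distr R (bool_PiM I) (cantor_decode I)) (cylinder I J) = (\<integral>t. digit_product I J t \<partial>R)"
proof -
  interpret real_distribution R by fact
  have [measurable]: "digit_product I J \<in> borel_measurable borel"
    by (rule borel_measurable_continuous_onI[OF continuous_on_digit_product])
  let ?C = "cantor_decode I -` cylinder I J \<inter> space R"
  have C: "?C \<in> sets R"
    by (rule measurable_sets[OF _ sets_cylinder[OF J(1)]]) simp
  have "measure (distr R (bool_PiM I) (cantor_decode I)) (cylinder I J) = measure R ?C"
    by (rule measure_distr) (use J in auto)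
  also have "\<dots> = (\<integral>t. indicator ?C t \<partial>R)"
    by simp
  also have "\<dots> = (\<integral>t. digit_product I J t \<partial>R)"
  proof (rule integral_cong_AE)
    have "AE t in R. \<forall>i\<in>J. cantor_digit (to_nat_on I i) t \<in> {0, 1}"
      using J digits by (intro AE_finite_allI) auto
    then show "AE t in R. indicator ?C t = digit_product I J t"
    proof eventually_elim
      case (elim t)
      then have "digit_product I J t = of_bool (\<forall>i\<in>J. cantor_digit (to_nat_on I i) t = 1)"
        using J(1) by (auto simp: digit_product_def)
      also have "\<dots> = of_bool (t \<in> ?C)"
        using J(2) by (auto simp: mem_cylinder_iff space_PiM cantor_decode_def)
      finally show ?case
        by (simp add: indicator_def)
    qed
  qed (use C in measurable)
  finally show ?thesis .
qed

lemma exists_weak_conv_subseq: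
  fixes \<rho> :: "nat \<Rightarrow> real measure"
  assumes "\<And>n. real_distribution (\<rho> n)" and support: "\<And>n. AE t in \<rho> n. t \<in> {a..b}"
  obtains s :: "nat \<Rightarrow> nat" and R where "strict_mono s" "real_distribution R" "weak_conv_m (\<lambda>n. \<rho> (s n)) R"
proof -
  have "tight \<rho>"
    unfolding tight_def
  proof (intro conjI allI impI assms(1))
    fix \<epsilon> :: real assume "0 < \<epsilon>"
    have "measure (\<rho> n) {a - 1<..max a b} = 1" for n
    proof -
      interpret real_distribution "\<rho> n"
        by (rule assms(1))
      have "AE t in \<rho> n. t \<in> {a - 1<..max a b}"
        using support[of n] by eventually_elim auto
      then show ?thesis
        by (simp add: prob_eq_1)
    qed
    with \<open>0 < \<epsilon>\<close> show "\<exists>a b. a < b \<and> (\<forall>n. 1 - \<epsilon> < measure (\<rho> n) {a<..b})"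
      by (intro exI[of _ "a - 1"] exI[of _ "max a b"]) auto
  qed
  from tight_imp_convergent_subsubsequence[OF this strict_mono_id] show thesis
    using that by (auto simp: comp_def)
qed

lemma AE_weak_conv_zero:
  fixes f :: "real \<Rightarrow> real"
  assumes "\<And>n. real_distribution (\<rho> n)" "real_distribution R" "weak_conv_m \<rho> R"
    and f: "continuous_on UNIV f" "\<And>t. f t \<in> {0..B}" and zero: "\<And>n. AE t in \<rho> n. f t = 0"
  shows "AE t in R. f t = 0"
proof -
  interpret R: real_distribution R by fact
  have [measurable]: "f \<in> borel_measurable borel"
    by (rule borel_measurable_continuous_onI[OF f(1)])
  have "(\<lambda>n. \<integral>t. f t \<partial>\<rho> n) \<longlonglongrightarrow> (\<integral>t. f t \<partial>R)"
    by (rule weak_conv_imp_integral_bdd_continuous_conv[OF assms(1-3), of f B])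
      (use f in \<open>auto simp: continuous_on_eq_continuous_at\<close>)
  moreover have "(\<integral>t. f t \<partial>\<rho> n) = 0" for n
    using zero by (rule integral_eq_zero_AE)
  ultimately have "(\<integral>t. f t \<partial>R) = 0"
    by (simp add: LIMSEQ_const_iff)
  moreover have "integrable R f"
    by (rule R.integrable_const_bound[where B=B]) (use f(2) in auto)
  ultimately show ?thesis
    using integral_nonneg_eq_0_iff_AE[of R f] f(2) by auto
qed

lemma AE_cantor_digit_weak_conv:
  assumes "\<And>n. real_distribution (\<rho> n)" "real_distribution R" "weak_conv_m \<rho> R"
    and "\<And>n. AE t in \<rho> n. cantor_digit i t \<in> {0, 1}"
  shows "AE t in R. cantor_digit i t \<in> {0, 1}"
proof -
  have "AE t in R. cantor_digit i t * (1 - cantor_digit i t) = 0"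
  proof (rule AE_weak_conv_zero[OF assms(1-3)])
    show "continuous_on UNIV (\<lambda>t. cantor_digit i t * (1 - cantor_digit i t))"
      by (intro continuous_intros)
    show "cantor_digit i t * (1 - cantor_digit i t) \<in> {0..1}" for t
      using cantor_digit_bounds[of i t] by (auto intro: mult_le_one)
    show "AE t in \<rho> n. cantor_digit i t * (1 - cantor_digit i t) = 0" for n
      using assms(4) by eventually_elim auto
  qed
  then show ?thesis
    by eventually_elim auto
qed

lemma
  assumes "countable I" "prob_space L" and sets_L [measurable_cong]: "sets L = sets (bool_PiM I)"
  shows real_distribution_cantor_code: "real_distribution (distr L borel (cantor_code I))"
    and AE_distr_cantor_code_range: "AE t in distr L borel (cantor_code I). t \<in> {0..1}"
    and AE_distr_cantor_code_digit:
      "i \<in> I \<Longrightarrow> AE t in distr L borel (cantor_code I). cantor_digit (to_nat_on I i) t \<in> {0, 1}"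
    and distr_cantor_decode_code: "distr (distr L borel (cantor_code I)) (bool_PiM I) (cantor_decode I) = L"
proof -
  show "real_distribution (distr L borel (cantor_code I))"
    by (rule prob_space.real_distribution_distr[OF assms(2)]) simp
  show "AE t in distr L borel (cantor_code I). t \<in> {0..1}"
    using cantor_bounds by (subst AE_distr_iff) (auto simp: cantor_code_def)
  show "AE t in distr L borel (cantor_code I). cantor_digit (to_nat_on I i) t \<in> {0, 1}" if "i \<in> I"
    using cantor_digit_code[OF assms(1) that] by (subst AE_distr_iff) auto
  have "distr (distr L borel (cantor_code I)) (bool_PiM I) (cantor_decode I)
      = distr L (bool_PiM I) (cantor_decode I \<circ> cantor_code I)"
    by (rule distr_distr) auto
  also have "\<dots> = distr L L (\<lambda>x. x)"
    using cantor_decode_code[OF assms(1)]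
    by (intro distr_cong) (auto simp: sets_L sets_eq_imp_space_eq[OF sets_L])
  finally show "distr (distr L borel (cantor_code I)) (bool_PiM I) (cantor_decode I) = L"
    by simp
qed

lemma bool_PiM_sequentially_compact:
  assumes "countable I" and L: "\<And>n. prob_space (L n)" "\<And>n. sets (L n) = sets (bool_PiM I)"
  obtains s :: "nat \<Rightarrow> nat" and \<Lambda> where "strict_mono s" "prob_space \<Lambda>"
    "sets \<Lambda> = sets (bool_PiM I)" "tendsto_on_cylinders I (\<lambda>n. L (s n)) \<Lambda>"
proof -
  define \<rho> where "\<rho> n = distr (L n) borel (cantor_code I)" for n
  note \<rho> = real_distribution_cantor_code[OF assms(1) L, folded \<rho>_def]
  note digits_\<rho> = AE_distr_cantor_code_digit[OF assms(1) L, folded \<rho>_def]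
  note decode_\<rho> = distr_cantor_decode_code[OF assms(1) L, folded \<rho>_def]
  obtain s R where s: "strict_mono s" and R: "real_distribution R"
    and weak_conv: "weak_conv_m (\<lambda>n. \<rho> (s n)) R"
    by (rule exists_weak_conv_subseq[OF \<rho> AE_distr_cantor_code_range[OF assms(1) L, folded \<rho>_def]])
  interpret R: real_distribution R by fact
  have digits_R: "AE t in R. cantor_digit (to_nat_on I i) t \<in> {0, 1}" if "i \<in> I" for i
    by (rule AE_cantor_digit_weak_conv[OF \<rho> R weak_conv digits_\<rho>[OF that]])
  let ?\<Lambda> = "distr R (bool_PiM I) (cantor_decode I)"
  show thesis
  proof (rule that[OF s])
    show "prob_space ?\<Lambda>"
      by (rule R.prob_space_distr) simp
    show "tendsto_on_cylinders I (\<lambda>n. L (s n)) ?\<Lambda>"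
      unfolding tendsto_on_cylinders_def
    proof (intro allI impI)
      fix J assume J: "finite J" "J \<subseteq> I"
      have "(\<lambda>n. \<integral>t. digit_product I J t \<partial>\<rho> (s n)) \<longlonglongrightarrow> (\<integral>t. digit_product I J t \<partial>R)"
        using continuous_on_digit_product[of I J] digit_product_bounds[of I J]
        by (intro weak_conv_imp_integral_bdd_continuous_conv[OF \<rho> R weak_conv, of _ 1])
          (auto simp: continuous_on_eq_continuous_at)
      then show "(\<lambda>n. measure (L (s n)) (cylinder I J)) \<longlonglongrightarrow> measure ?\<Lambda> (cylinder I J)"
        using measure_distr_cantor_decode_cylinder[OF \<rho> J digits_\<rho>]
          measure_distr_cantor_decode_cylinder[OF R J digits_R] by (simp add: decode_\<rho>)
    qed
  qed simp
qed

section \<open>Averages along a random walk\<close>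

lemma integrable_pmf_bounded:
  fixes f :: "'b \<Rightarrow> real"
  assumes "\<And>x. \<bar>f x\<bar> \<le> B"
  shows "integrable (measure_pmf p) f"
  by (rule measure_pmf.integrable_const_bound[where B=B]) (use assms in auto)

lemma abs_expectation_pmf_le:
  fixes f :: "'b \<Rightarrow> real"
  assumes "\<And>x. \<bar>f x\<bar> \<le> B"
  shows "\<bar>measure_pmf.expectation p f\<bar> \<le> B"
proof -
  have "\<bar>measure_pmf.expectation p f\<bar> \<le> measure_pmf.expectation p (\<lambda>x. \<bar>f x\<bar>)"
    by (rule integral_abs_bound)
  also have "\<dots> \<le> measure_pmf.expectation p (\<lambda>_. B)"
    using assms by (intro integral_mono integrable_abs integrable_pmf_bounded[OF assms]) auto
  finally show ?thesis
    by simp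
qed

lemma expectation_pmf_cong:
  fixes f :: "'b \<Rightarrow> real"
  assumes "\<And>x. x \<in> set_pmf p \<Longrightarrow> f x = g x"
  shows "measure_pmf.expectation p f = measure_pmf.expectation p g"
  by (rule integral_cong_AE) (use assms in \<open>auto simp: AE_measure_pmf_iff\<close>)

lemma expectation_bind_pmf_bounded:
  fixes f :: "'b \<Rightarrow> real"
  assumes "\<And>x. \<bar>f x\<bar> \<le> B"
  shows "measure_pmf.expectation (bind_pmf p q) f
    = measure_pmf.expectation p (\<lambda>x. measure_pmf.expectation (q x) f)"
  unfolding measure_pmf_bind
  by (rule integral_bind[where K="count_space UNIV" and B=B and B'=1])
    (use assms in \<open>auto simp: measure_pmf.finite_measure_axioms measure_pmf_in_subprob_algebra
       measure_pmf.emeasure_le_1 intro: measurable_measure_pmf\<close>)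

lemma pmf_mult_le_expectation:
  assumes "\<And>x. 0 \<le> f x" "\<And>x. f x \<le> B"
  shows "pmf p x * f x \<le> measure_pmf.expectation p f"
proof -
  have "pmf p x * f x = measure_pmf.expectation p (\<lambda>y. indicator {x} y * f x)"
    by (simp add: measure_pmf_single)
  also have "\<dots> \<le> measure_pmf.expectation p f"
  proof (rule integral_mono)
    show "integrable (measure_pmf p) (\<lambda>y. indicator {x} y * f x)"
      by (rule integrable_pmf_bounded[where B="f x"]) (use assms(1) in \<open>simp add: indicator_def\<close>)
    show "integrable (measure_pmf p) f"
      by (rule integrable_pmf_bounded[where B=B]) (use assms in simp)
  qed (use assms(1) in \<open>simp add: indicator_def\<close>)
  finally show ?thesis .
qed

lemma has_sum_pmf_expectation:
  fixes f :: "'g \<Rightarrow> real"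
  assumes "set_pmf m \<subseteq> C" and bounded: "\<And>g. \<bar>f g\<bar> \<le> B"
  shows "((\<lambda>g. pmf m g * f g) has_sum measure_pmf.expectation m f) C"
proof -
  let ?h = "\<lambda>g. pmf m g * f g"
  have "Infinite_Set_Sum.abs_summable_on (\<lambda>g. B * pmf m g) UNIV"
    using pmf_abs_summable[of m UNIV] by (rule abs_summable_on_cmult_right)
  then have abs_summable: "Infinite_Set_Sum.abs_summable_on ?h UNIV"
  proof (rule abs_summable_on_comparison_test)
    fix g
    have "pmf m g * \<bar>f g\<bar> \<le> pmf m g * B"
      by (rule mult_left_mono[OF bounded]) simp
    then have "norm (?h g) \<le> B * pmf m g"
      by (simp add: abs_mult mult.commute)
    also have "\<dots> \<le> norm (B * pmf m g)"
      by simp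
    finally show "norm (?h g) \<le> norm (B * pmf m g)" .
  qed
  then have "?h summable_on UNIV"
    by (rule abs_summable_summable[OF abs_summable_equivalent[THEN iffD2]])
  then have "(?h has_sum infsum ?h UNIV) UNIV"
    by simp
  also have "infsum ?h UNIV = measure_pmf.expectation m f"
    using abs_summable by (simp add: pmf_expectation_eq_infsetsum infsetsum_infsum)
  finally show ?thesis
    using has_sum_cong_neutral[of UNIV C ?h ?h] assms(1) by (auto simp: set_pmf_iff subset_iff)
qed

lemma exists_pmf_of_has_sum:
  fixes w :: "'g \<Rightarrow> real"
  assumes nonneg: "\<And>g. 0 \<le> w g" and zero: "\<And>g. g \<notin> C \<Longrightarrow> w g = 0" and "(w has_sum 1) C"
  obtains m :: "'g pmf" where "pmf m = w" "set_pmf m = {g \<in> C. 0 < w g}"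
proof -
  have sum: "(w has_sum 1) UNIV"
    using assms(3) has_sum_cong_neutral[of UNIV C w w 1] zero by auto
  then have "Infinite_Sum.abs_summable_on w UNIV"
    using nonneg by (simp add: has_sum_imp_summable)
  then have abs_summable: "Infinite_Set_Sum.abs_summable_on w UNIV"
    by (rule abs_summable_equivalent[THEN iffD1])
  have "(\<integral>\<^sup>+x. ennreal (w x) \<partial>count_space UNIV) = ennreal (infsetsum w UNIV)"
    by (rule nn_integral_conv_infsetsum[OF abs_summable]) (use nonneg in auto)
  also have "\<dots> = 1"
    using sum by (simp add: infsetsum_infsum[OF abs_summable] infsumI)
  finally have "pmf (embed_pmf w) g = w g" for g
    using nonneg by (intro pmf_embed_pmf) auto
  then have "pmf (embed_pmf w) = w"
    by auto
  moreover from this have "set_pmf (embed_pmf w) = {g \<in> C. 0 < w g}"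
    using nonneg zero by (auto simp: set_pmf_eq less_le)
  ultimately show thesis
    by (rule that)
qed

primrec random_walk :: "('g, 'b) monoid_scheme \<Rightarrow> 'g pmf \<Rightarrow> nat \<Rightarrow> 'g pmf" where
  "random_walk G m 0 = return_pmf \<one>\<^bsub>G\<^esub>"
| "random_walk G m (Suc i) = bind_pmf m (\<lambda>g. map_pmf (\<lambda>k. g \<otimes>\<^bsub>G\<^esub> k) (random_walk G m i))"

definition cesaro_walk :: "('g, 'b) monoid_scheme \<Rightarrow> 'g pmf \<Rightarrow> nat \<Rightarrow> 'g pmf" where
  "cesaro_walk G m N = bind_pmf (pmf_of_set {..N}) (random_walk G m)"

lemma expectation_random_walk_Suc:
  fixes f :: "'g \<Rightarrow> real"
  assumes "\<And>x. \<bar>f x\<bar> \<le> B"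
  shows "measure_pmf.expectation (random_walk G m (Suc i)) f =
    measure_pmf.expectation m (\<lambda>g. measure_pmf.expectation (random_walk G m i) (\<lambda>k. f (g \<otimes>\<^bsub>G\<^esub> k)))"
  by (simp add: expectation_bind_pmf_bounded[where f=f and B=B, OF assms])

lemma expectation_cesaro_walk:
  fixes f :: "'g \<Rightarrow> real"
  assumes "\<And>x. \<bar>f x\<bar> \<le> B"
  shows "measure_pmf.expectation (cesaro_walk G m N) f =
    (\<Sum>i\<le>N. measure_pmf.expectation (random_walk G m i) f) / real (Suc N)"
  unfolding cesaro_walk_def
  by (simp add: expectation_bind_pmf_bounded[where f=f and B=B, OF assms] integral_pmf_of_set)

lemma cesaro_walk_almost_stationary:
  fixes f :: "'g \<Rightarrow> real"
  assumes bounded: "\<And>x. \<bar>f x\<bar> \<le> B"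
  shows "\<bar>measure_pmf.expectation m (\<lambda>g. measure_pmf.expectation (cesaro_walk G m N) (\<lambda>k. f (g \<otimes>\<^bsub>G\<^esub> k)))
    - measure_pmf.expectation (cesaro_walk G m N) f\<bar> \<le> 2 * B / real (Suc N)"
    (is "\<bar>?shifted - ?average\<bar> \<le> _")
proof -
  let ?E = "\<lambda>i. measure_pmf.expectation (random_walk G m i)"
  have "?shifted = measure_pmf.expectation m (\<lambda>g. (\<Sum>i\<le>N. ?E i (\<lambda>k. f (g \<otimes>\<^bsub>G\<^esub> k))) / real (Suc N))"
    by (subst expectation_cesaro_walk[where B=B]) (use bounded in auto)
  also have "\<dots> = (\<Sum>i\<le>N. measure_pmf.expectation m (\<lambda>g. ?E i (\<lambda>k. f (g \<otimes>\<^bsub>G\<^esub> k)))) / real (Suc N)"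
    by (subst integral_divide_zero, subst Bochner_Integration.integral_sum)
      (auto intro!: integrable_pmf_bounded[where B=B] abs_expectation_pmf_le bounded)
  also have "\<dots> = (\<Sum>i\<le>N. ?E (Suc i) f) / real (Suc N)"
    by (simp only: expectation_random_walk_Suc[where f=f and B=B, OF bounded])
  finally have "?shifted - ?average = ((\<Sum>i\<le>N. ?E (Suc i) f) - (\<Sum>i\<le>N. ?E i f)) / real (Suc N)"
    by (simp only: expectation_cesaro_walk[where f=f and B=B, OF bounded] diff_divide_distrib)
  also have "(\<Sum>i\<le>N. ?E (Suc i) f) - (\<Sum>i\<le>N. ?E i f) = ?E (Suc N) f - ?E 0 f"
    by (induction N) (simp_all del: random_walk.simps)
  finally have telescoped: "\<bar>?shifted - ?average\<bar> = \<bar>?E (Suc N) f - ?E 0 f\<bar> / real (Suc N)"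
    by (simp only: abs_divide abs_of_nat)
  have "\<bar>?E (Suc N) f - ?E 0 f\<bar> \<le> 2 * B"
    using abs_expectation_pmf_le[of f B "random_walk G m (Suc N)", OF bounded]
      abs_expectation_pmf_le[of f B "random_walk G m 0", OF bounded] by linarith
  with telescoped show ?thesis
    by (simp add: divide_right_mono)
qed

definition generating_pmf :: "('g, 'b) monoid_scheme \<Rightarrow> 'g pmf \<Rightarrow> bool" where
  "generating_pmf G m \<longleftrightarrow> semigroup_generated G (set_pmf m) = carrier G"

lemma set_pmf_subset_of_generating: "generating_pmf G m \<Longrightarrow> set_pmf m \<subseteq> carrier G"
  using semigroup_generated.base[of _ "set_pmf m" G] by (auto simp: generating_pmf_def)

context monoid
begin

lemma set_random_walk_subset:
  assumes "set_pmf m \<subseteq> carrier G"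
  shows "set_pmf (random_walk G m i) \<subseteq> carrier G"
  using assms by (induction i) (auto simp: subset_iff)

lemma set_cesaro_walk_subset:
  assumes "set_pmf m \<subseteq> carrier G"
  shows "set_pmf (cesaro_walk G m N) \<subseteq> carrier G"
  using set_random_walk_subset[OF assms] by (auto simp: cesaro_walk_def)

lemma random_walk_mult_mem:
  assumes "set_pmf m \<subseteq> carrier G"
    and "x \<in> set_pmf (random_walk G m i)" "y \<in> set_pmf (random_walk G m j)"
  shows "x \<otimes> y \<in> set_pmf (random_walk G m (i + j))"
  using assms(2)
proof (induction i arbitrary: x)
  case 0
  have "y \<in> carrier G"
    using set_random_walk_subset[OF assms(1)] assms(3) by blast
  with 0 assms(3) show ?case
    by simp
next
  case (Suc i)
  then obtain g k where gk: "g \<in> set_pmf m" "k \<in> set_pmf (random_walk G m i)" "x = g \<otimes> k"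
    by auto
  then have "x \<otimes> y = g \<otimes> (k \<otimes> y)"
    using set_random_walk_subset[OF assms(1)] assms(1,3) by (metis m_assoc subsetD)
  with gk Suc.IH show ?case
    by auto
qed

lemma exists_random_walk_mem:
  assumes "generating_pmf G m" "g \<in> carrier G"
  shows "\<exists>i. g \<in> set_pmf (random_walk G m i)"
proof -
  have "g \<in> semigroup_generated G (set_pmf m)"
    using assms by (simp add: generating_pmf_def)
  then show ?thesis
  proof induction
    case (base s)
    then have "s = s \<otimes> \<one>"
      using set_pmf_subset_of_generating[OF assms(1)] by auto
    with base have "s \<in> set_pmf (random_walk G m (Suc 0))"
      by auto
    then show ?case ..
  next
    case (mult x y)
    then show ?case
      using random_walk_mult_mem[OF set_pmf_subset_of_generating[OF assms(1)]] by blast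
  qed
qed

end

section \<open>Stationary actions\<close>

lemma measure_vimage_cong_AE:
  assumes "S \<in> M \<rightarrow>\<^sub>M N" "T \<in> M \<rightarrow>\<^sub>M N" "AE x in M. S x = T x" "A \<in> sets N"
  shows "measure M (S -` A \<inter> space M) = measure M (T -` A \<inter> space M)"
  using assms by (intro measure_eq_AE) auto

lemma AE_nonsingular:
  assumes "nonsingular M T" "AE x in M. P x"
  shows "AE x in M. P (T x)"
proof -
  obtain N where N: "{x \<in> space M. \<not> P x} \<subseteq> N" "N \<in> null_sets M"
    using assms(2) by (auto elim!: AE_E simp: null_sets_def)
  have T: "T \<in> M \<rightarrow>\<^sub>M M" and "T -` N \<inter> space M \<in> null_sets M"
    using assms(1) N(2) by (auto simp: nonsingular_def null_sets_def)
  then show ?thesis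
    using N(1) measurable_space[OF T] by (intro AE_I'[of "T -` N \<inter> space M"]) auto
qed

lemma nonsingularI_right_inverse:
  assumes T: "T \<in> M \<rightarrow>\<^sub>M M" "\<And>N. N \<in> null_sets M \<Longrightarrow> T -` N \<inter> space M \<in> null_sets M"
    and S: "S \<in> M \<rightarrow>\<^sub>M M" "\<And>N. N \<in> null_sets M \<Longrightarrow> S -` N \<inter> space M \<in> null_sets M"
    and inverse: "AE x in M. T (S x) = x"
  shows "nonsingular M T"
  unfolding nonsingular_def
proof (intro conjI ballI iffI)
  fix A assume A: "A \<in> sets M"
  show "A \<in> null_sets M" if "T -` A \<inter> space M \<in> null_sets M"
  proof -
    have "AE x in M. x \<in> S -` (T -` A \<inter> space M) \<inter> space M \<longleftrightarrow> x \<in> A"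
      using inverse AE_space
      by eventually_elim (use measurable_space[OF S(1)] sets.sets_into_space[OF A] in auto)
    then have "emeasure M (S -` (T -` A \<inter> space M) \<inter> space M) = emeasure M A"
      using S(1) T(1) A by (intro emeasure_eq_AE) auto
    with S(2)[OF that] A show ?thesis
      by (simp add: null_sets_def)
  qed
qed (use T in auto)

locale stationary_action = group G + prob_space M
  for G :: "('g, 'b) monoid_scheme" (structure) and M :: "'x measure" +
  fixes m :: "'g pmf" and a :: "'g \<Rightarrow> 'x \<Rightarrow> 'x"
  assumes set_pmf_subset_carrier: "set_pmf m \<subseteq> carrier G"
    and measurable_action [measurable]: "g \<in> carrier G \<Longrightarrow> a g \<in> M \<rightarrow>\<^sub>M M"
    and AE_action_mult: "g \<in> carrier G \<Longrightarrow> h \<in> carrier G \<Longrightarrow> AE x in M. a (g \<otimes> h) x = a g (a h x)"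
    and AE_action_one: "AE x in M. a \<one> x = x"
    and stationary: "A \<in> sets M \<Longrightarrow>
      measure_pmf.expectation m (\<lambda>g. measure M (a g -` A \<inter> space M)) = measure M A"
begin

lemma AE_action_inv:
  assumes "g \<in> carrier G"
  shows "AE x in M. a (inv g) (a g x) = x" "AE x in M. a g (a (inv g) x) = x"
  using AE_action_mult[of "inv g" g] AE_action_mult[of g "inv g"] AE_action_one assms by auto

lemma measure_vimage_action_mult:
  assumes "g \<in> carrier G" "h \<in> carrier G" "A \<in> sets M"
  shows "measure M (a (g \<otimes> h) -` A \<inter> space M) = measure M (a h -` (a g -` A \<inter> space M) \<inter> space M)"
proof -
  have "measure M (a (g \<otimes> h) -` A \<inter> space M) = measure M ((a g \<circ> a h) -` A \<inter> space M)"
    using AE_action_mult[OF assms(1,2)] assms by (intro measure_vimage_cong_AE) auto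
  also have "(a g \<circ> a h) -` A \<inter> space M = a h -` (a g -` A \<inter> space M) \<inter> space M"
    using measurable_space[OF measurable_action[OF assms(2)]] by auto
  finally show ?thesis .
qed

lemma measure_vimage_action_one:
  assumes "A \<in> sets M"
  shows "measure M (a \<one> -` A \<inter> space M) = measure M A"
proof -
  have "measure M (a \<one> -` A \<inter> space M) = measure M ((\<lambda>x. x) -` A \<inter> space M)"
    using AE_action_one assms by (intro measure_vimage_cong_AE) auto
  then show ?thesis
    using sets.sets_into_space[OF assms] by (simp add: Int_absorb2)
qed

lemma random_walk_stationary:
  assumes "A \<in> sets M"
  shows "measure_pmf.expectation (random_walk G m i) (\<lambda>k. measure M (a k -` A \<inter> space M)) = measure M A"
  using assms
proof (induction i arbitrary: A)
  case 0
  then show ?case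
    by (simp add: measure_vimage_action_one)
next
  case (Suc i)
  let ?E = "measure_pmf.expectation (random_walk G m i)"
  have step: "?E (\<lambda>k. measure M (a (g \<otimes> k) -` A \<inter> space M)) = measure M (a g -` A \<inter> space M)"
    if "g \<in> set_pmf m" for g
  proof -
    have g: "g \<in> carrier G"
      using that set_pmf_subset_carrier by auto
    have "?E (\<lambda>k. measure M (a (g \<otimes> k) -` A \<inter> space M))
        = ?E (\<lambda>k. measure M (a k -` (a g -` A \<inter> space M) \<inter> space M))"
      using set_random_walk_subset[OF set_pmf_subset_carrier] g Suc.prems
      by (intro expectation_pmf_cong measure_vimage_action_mult) auto
    also have "\<dots> = measure M (a g -` A \<inter> space M)"
      using g Suc.prems by (intro Suc.IH) measurable
    finally show ?thesis .
  qed
  have "measure_pmf.expectation (random_walk G m (Suc i)) (\<lambda>k. measure M (a k -` A \<inter> space M))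
      = measure_pmf.expectation m (\<lambda>g. ?E (\<lambda>k. measure M (a (g \<otimes> k) -` A \<inter> space M)))"
    by (rule expectation_random_walk_Suc[where B=1]) simp
  also have "\<dots> = measure_pmf.expectation m (\<lambda>g. measure M (a g -` A \<inter> space M))"
    by (rule expectation_pmf_cong[OF step])
  finally show ?case
    by (simp add: stationary[OF Suc.prems])
qed

lemma cesaro_walk_stationary:
  assumes "A \<in> sets M"
  shows "measure_pmf.expectation (cesaro_walk G m N) (\<lambda>k. measure M (a k -` A \<inter> space M)) = measure M A"
  by (subst expectation_cesaro_walk[where B=1]) (simp_all add: random_walk_stationary[OF assms])

lemma measure_vimage_action_le:
  assumes "g \<in> set_pmf (random_walk G m i)" "A \<in> sets M"
  shows "measure M (a g -` A \<inter> space M) \<le> measure M A / pmf (random_walk G m i) g"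
proof -
  have "pmf (random_walk G m i) g * measure M (a g -` A \<inter> space M)
      \<le> measure_pmf.expectation (random_walk G m i) (\<lambda>k. measure M (a k -` A \<inter> space M))"
    by (rule pmf_mult_le_expectation[where B=1]) simp_all
  with assms show ?thesis
    by (simp add: random_walk_stationary field_simps pmf_positive)
qed

lemma nonsingular_action:
  assumes generating: "generating_pmf G m" and g: "g \<in> carrier G"
  shows "nonsingular M (a g)"
proof -
  have null: "a h -` N \<inter> space M \<in> null_sets M" if h: "h \<in> carrier G" and N: "N \<in> null_sets M" for h N
  proof -
    obtain i where "h \<in> set_pmf (random_walk G m i)"
      using exists_random_walk_mem[OF generating h] by blast
    from measure_vimage_action_le[OF this null_setsD2[OF N]] have "measure M (a h -` N \<inter> space M) = 0"
      using N by (simp add: measure_eq_0_null_sets measure_le_0_iff)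
    then show ?thesis
      using h N by (auto simp: null_sets_def emeasure_eq_measure)
  qed
  show ?thesis
    using g by (intro nonsingularI_right_inverse[where S="a (inv g)"] null AE_action_inv) auto
qed

end

lemma A_mu_iff_stationary_action:
  assumes "group G" "prob_space M" and generating: "generating_pmf G m"
  shows "a \<in> A_mu G (pmf m) M \<longleftrightarrow> stationary_action G M m a"
proof -
  interpret group G by fact
  interpret prob_space M by fact
  note subset = set_pmf_subset_of_generating[OF generating]
  have has_sum_iff: "((\<lambda>g. pmf m g * measure (distr M M (a g)) A) has_sum measure M A) (carrier G)
      \<longleftrightarrow> measure_pmf.expectation m (\<lambda>g. measure M (a g -` A \<inter> space M)) = measure M A"
    if "\<And>g. g \<in> carrier G \<Longrightarrow> a g \<in> M \<rightarrow>\<^sub>M M" "A \<in> sets M" for A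
  proof -
    have "((\<lambda>g. pmf m g * measure M (a g -` A \<inter> space M)) has_sum
        measure_pmf.expectation m (\<lambda>g. measure M (a g -` A \<inter> space M))) (carrier G)"
      by (rule has_sum_pmf_expectation[OF subset, where B=1]) simp
    moreover have "((\<lambda>g. pmf m g * measure (distr M M (a g)) A) has_sum measure M A) (carrier G)
        \<longleftrightarrow> ((\<lambda>g. pmf m g * measure M (a g -` A \<inter> space M)) has_sum measure M A) (carrier G)"
      using that by (intro has_sum_cong) (simp add: measure_distr)
    ultimately show ?thesis
      using has_sum_unique by fastforce
  qed
  show ?thesis
  proof
    assume a: "a \<in> A_mu G (pmf m) M"
    then have "a g \<in> M \<rightarrow>\<^sub>M M" if "g \<in> carrier G" for g
      using that by (auto simp: A_mu_def is_action_def nonsingular_def)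
    with a has_sum_iff subset show "stationary_action G M m a"
      by unfold_locales (auto simp: A_mu_def is_action_def)
  next
    assume "stationary_action G M m a"
    then interpret stationary_action G M m a .
    show "a \<in> A_mu G (pmf m) M"
      using nonsingular_action[OF generating] AE_action_mult AE_action_one stationary
      by (auto simp: A_mu_def is_action_def has_sum_iff)
  qed
qed

lemma stationary_action_trivial:
  assumes "group G" "prob_space M" "set_pmf m \<subseteq> carrier G"
  shows "stationary_action G M m (\<lambda>_ x. x)"
proof -
  interpret group G by fact
  interpret prob_space M by fact
  show ?thesis
    using assms(3) by unfold_locales (auto simp: Int_absorb2[OF sets.sets_into_space])
qed

lemma measure_vimage_conjugate:
  assumes iso: "mod0_iso M N \<theta> \<theta>'" and [measurable]: "T \<in> M \<rightarrow>\<^sub>M M" "A \<in> sets N"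
  shows "measure N ((\<theta> \<circ> T \<circ> \<theta>') -` A \<inter> space N) = measure M (T -` (\<theta> -` A \<inter> space M) \<inter> space M)"
proof -
  note [measurable] = mod0_isoD(1,2)[OF iso]
  have "(\<theta> \<circ> T \<circ> \<theta>') -` A \<inter> space N = \<theta>' -` (T -` (\<theta> -` A \<inter> space M) \<inter> space M) \<inter> space N"
    using measurable_space[of T M M] measurable_space[of \<theta>' N M] by auto
  moreover have "T -` (\<theta> -` A \<inter> space M) \<inter> space M \<in> sets M"
    by measurable
  ultimately show ?thesis
    by (simp only: measure_vimage_mod0_iso[OF mod0_iso_sym[OF iso]])
qed

lemma (in stationary_action) stationary_action_conjugate:
  assumes generating: "generating_pmf G m" and iso: "mod0_iso M N \<theta> \<theta>'"
  shows "stationary_action G N m (\<lambda>g. \<theta> \<circ> a g \<circ> \<theta>')"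
proof -
  note [measurable] = mod0_isoD(1,2)[OF iso]
  interpret N: prob_space N
    using prob_space_distr[OF mod0_isoD(1)[OF iso]] by (simp add: mod0_isoD(3)[OF iso])
  note AE_N = AE_mod0_iso[OF mod0_iso_sym[OF iso]]
  show ?thesis
  proof unfold_locales
    show "\<theta> \<circ> a g \<circ> \<theta>' \<in> N \<rightarrow>\<^sub>M N" if "g \<in> carrier G" for g
      using that by measurable
    show "AE y in N. (\<theta> \<circ> a (g \<otimes> h) \<circ> \<theta>') y = (\<theta> \<circ> a g \<circ> \<theta>') ((\<theta> \<circ> a h \<circ> \<theta>') y)"
      if "g \<in> carrier G" "h \<in> carrier G" for g h
    proof -
      have "AE x in M. \<theta> (a (g \<otimes> h) x) = \<theta> (a g (\<theta>' (\<theta> (a h x))))"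
        using AE_nonsingular[OF nonsingular_action[OF generating that(2)] mod0_isoD(4)[OF iso]]
          AE_action_mult[OF that] by eventually_elim simp
      from AE_N[OF this] show ?thesis
        by simp
    qed
    show "AE y in N. (\<theta> \<circ> a \<one> \<circ> \<theta>') y = y"
      using AE_N[OF AE_action_one] mod0_isoD(5)[OF iso] by eventually_elim simp
    fix A assume A: "A \<in> sets N"
    let ?A = "\<theta> -` A \<inter> space M"
    have "measure_pmf.expectation m (\<lambda>g. measure N ((\<theta> \<circ> a g \<circ> \<theta>') -` A \<inter> space N))
        = measure_pmf.expectation m (\<lambda>g. measure M (a g -` ?A \<inter> space M))"
      using set_pmf_subset_carrier A by (intro expectation_pmf_cong measure_vimage_conjugate[OF iso]) auto
    also have "\<dots> = measure M ?A"
      by (rule stationary) (use A in measurable)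
    also have "\<dots> = measure N A"
      by (rule measure_vimage_mod0_iso[OF iso A])
    finally show "measure_pmf.expectation m (\<lambda>g. measure N ((\<theta> \<circ> a g \<circ> \<theta>') -` A \<inter> space N)) = measure N A" .
  qed (rule set_pmf_subset_carrier)
qed

section \<open>Stationary measures on the shift\<close>

abbreviation shift_space :: "('g, 'b) monoid_scheme \<Rightarrow> ('i \<times> 'g \<Rightarrow> bool) measure" where
  "shift_space G \<equiv> bool_PiM (UNIV \<times> carrier G)"

definition coord_shift :: "('g, 'b) monoid_scheme \<Rightarrow> 'g \<Rightarrow> ('i \<times> 'g \<Rightarrow> bool) \<Rightarrow> 'i \<times> 'g \<Rightarrow> bool" where
  "coord_shift G g x = (\<lambda>(i, h)\<in>UNIV \<times> carrier G. x (i, h \<otimes>\<^bsub>G\<^esub> g))"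

lemma measurable_coord_shift [measurable]: "coord_shift G g \<in> shift_space G \<rightarrow>\<^sub>M shift_space G"
  unfolding coord_shift_def case_prod_beta by (rule measurable_restrict) measurable

lemma coord_shift_space: "coord_shift G g x \<in> space (shift_space G)"
  by (auto simp: coord_shift_def space_PiM)

context group
begin

lemma coord_shift_mult:
  assumes "g \<in> carrier G" "h \<in> carrier G"
  shows "coord_shift G (g \<otimes> h) x = coord_shift G g (coord_shift G h x)"
  using assms by (auto simp: coord_shift_def fun_eq_iff restrict_def m_assoc)

lemma coord_shift_one:
  assumes "x \<in> space (shift_space G)"
  shows "coord_shift G \<one> x = x"
  using assms by (auto simp: coord_shift_def fun_eq_iff restrict_def space_PiM PiE_def extensional_def)

lemma coord_shift_vimage_cylinder:
  assumes "g \<in> carrier G" "J \<subseteq> UNIV \<times> carrier G"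
  shows "coord_shift G g -` cylinder (UNIV \<times> carrier G) J \<inter> space (shift_space G)
    = cylinder (UNIV \<times> carrier G) ((\<lambda>(i, h). (i, h \<otimes> g)) ` J)"
proof -
  have "coord_shift G g x (i, h) \<longleftrightarrow> x (i, h \<otimes> g)" if "(i, h) \<in> J" for x i h
    using that assms by (auto simp: coord_shift_def)
  then show ?thesis
    using coord_shift_space[of G g] by (fastforce simp: mem_cylinder_iff)
qed

end

definition shift_average ::
  "('g, 'b) monoid_scheme \<Rightarrow> 'g pmf \<Rightarrow> ('i \<times> 'g \<Rightarrow> bool) measure \<Rightarrow> ('i \<times> 'g \<Rightarrow> bool) measure" where
  "shift_average G p \<rho> = measure_pmf p \<bind> (\<lambda>k. distr \<rho> (shift_space G) (coord_shift G k))"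

lemma
  assumes "prob_space \<rho>" and sets_\<rho> [measurable_cong]: "sets \<rho> = sets (shift_space G)"
  shows prob_space_shift_average: "prob_space (shift_average G p \<rho>)"
    and sets_shift_average: "sets (shift_average G p \<rho>) = sets (shift_space G)"
    and measure_shift_average: "Z \<in> sets (shift_space G) \<Longrightarrow> measure (shift_average G p \<rho>) Z =
      measure_pmf.expectation p (\<lambda>k. measure \<rho> (coord_shift G k -` Z \<inter> space (shift_space G)))"
proof -
  interpret prob_space \<rho> by fact
  let ?\<kappa> = "\<lambda>k. distr \<rho> (shift_space G) (coord_shift G k)"
  have prob_\<kappa>: "prob_space (?\<kappa> k)" for k
    by (rule prob_space_distr) simp
  then have \<kappa>: "?\<kappa> \<in> measure_pmf p \<rightarrow>\<^sub>M subprob_algebra (shift_space G)"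
    by (auto simp: space_subprob_algebra intro: prob_space_imp_subprob_space)
  show "prob_space (shift_average G p \<rho>)"
    unfolding shift_average_def by (rule measure_pmf.prob_space_bind[OF _ \<kappa>]) (simp add: prob_\<kappa>)
  show "sets (shift_average G p \<rho>) = sets (shift_space G)"
    unfolding shift_average_def by (rule sets_bind) auto
  show "measure (shift_average G p \<rho>) Z =
      measure_pmf.expectation p (\<lambda>k. measure \<rho> (coord_shift G k -` Z \<inter> space (shift_space G)))"
    if "Z \<in> sets (shift_space G)"
    unfolding shift_average_def using that
    by (simp add: measure_pmf.measure_bind[OF \<kappa>] measure_distr sets_eq_imp_space_eq[OF sets_\<rho>])
qed

context group
begin

lemma stationary_action_coord_shift:
  assumes "prob_space \<Lambda>" and sets_\<Lambda> [measurable_cong]: "sets \<Lambda> = sets (shift_space G)"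
    and "set_pmf m \<subseteq> carrier G" and invariant: "shift_average G m \<Lambda> = \<Lambda>"
  shows "stationary_action G \<Lambda> m (coord_shift G)"
proof -
  interpret prob_space \<Lambda> by fact
  note space_\<Lambda> = sets_eq_imp_space_eq[OF sets_\<Lambda>]
  show ?thesis
  proof unfold_locales
    show "AE x in \<Lambda>. coord_shift G (g \<otimes> h) x = coord_shift G g (coord_shift G h x)"
      if "g \<in> carrier G" "h \<in> carrier G" for g h
      by (simp add: coord_shift_mult[OF that])
    show "AE x in \<Lambda>. coord_shift G \<one> x = x"
      by (rule AE_I2) (simp add: space_\<Lambda> coord_shift_one)
    show "measure_pmf.expectation m (\<lambda>g. measure \<Lambda> (coord_shift G g -` Z \<inter> space \<Lambda>)) = measure \<Lambda> Z"
      if "Z \<in> sets \<Lambda>" for Z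
      using that measure_shift_average[OF assms(1,2), of Z m]
      by (simp add: invariant sets_\<Lambda> space_\<Lambda>)
  qed (use assms(3) in measurable)
qed

lemma measure_shift_average_vimage_coord_shift:
  assumes "prob_space \<rho>" "sets \<rho> = sets (shift_space G)"
    and "set_pmf p \<subseteq> carrier G" "g \<in> carrier G" and Z: "Z \<in> sets (shift_space G)"
  shows "measure (shift_average G p \<rho>) (coord_shift G g -` Z \<inter> space (shift_space G))
    = measure_pmf.expectation p (\<lambda>k. measure \<rho> (coord_shift G (g \<otimes> k) -` Z \<inter> space (shift_space G)))"
proof -
  have "measure (shift_average G p \<rho>) (coord_shift G g -` Z \<inter> space (shift_space G))
      = measure_pmf.expectation p (\<lambda>k. measure \<rho> (coord_shift G k -`
          (coord_shift G g -` Z \<inter> space (shift_space G)) \<inter> space (shift_space G)))"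
    using Z by (intro measure_shift_average assms) measurable
  also have "\<dots> = measure_pmf.expectation p
      (\<lambda>k. measure \<rho> (coord_shift G (g \<otimes> k) -` Z \<inter> space (shift_space G)))"
  proof (rule expectation_pmf_cong)
    fix k assume "k \<in> set_pmf p"
    then have "coord_shift G k -` (coord_shift G g -` Z \<inter> space (shift_space G))
        = coord_shift G (g \<otimes> k) -` Z"
      using assms(3,4) coord_shift_space[of G k] by (auto simp: coord_shift_mult subset_iff)
    then show "measure \<rho> (coord_shift G k -` (coord_shift G g -` Z \<inter> space (shift_space G))
        \<inter> space (shift_space G)) = measure \<rho> (coord_shift G (g \<otimes> k) -` Z \<inter> space (shift_space G))"
      by simp
  qed
  finally show ?thesis .
qed

lemma shift_average_cesaro_walk_almost_invariant:
  assumes \<rho>: "prob_space \<rho>" "sets \<rho> = sets (shift_space G)"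
    and m: "set_pmf m \<subseteq> carrier G" and Z: "Z \<in> sets (shift_space G)"
  shows "\<bar>measure (shift_average G m (shift_average G (cesaro_walk G m N) \<rho>)) Z
    - measure (shift_average G (cesaro_walk G m N) \<rho>) Z\<bar> \<le> 2 / real (Suc N)"
proof -
  let ?p = "cesaro_walk G m N"
  define f where "f k = measure \<rho> (coord_shift G k -` Z \<inter> space (shift_space G))" for k
  have "measure (shift_average G ?p \<rho>) (coord_shift G g -` Z \<inter> space (shift_space G))
      = measure_pmf.expectation ?p (\<lambda>k. f (g \<otimes> k))" if "g \<in> set_pmf m" for g
    unfolding f_def using that m
    by (intro measure_shift_average_vimage_coord_shift[OF \<rho> set_cesaro_walk_subset[OF m] _ Z]) blast
  then have "measure (shift_average G m (shift_average G ?p \<rho>)) Z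
      = measure_pmf.expectation m (\<lambda>g. measure_pmf.expectation ?p (\<lambda>k. f (g \<otimes> k)))"
    unfolding measure_shift_average[OF prob_space_shift_average[OF \<rho>] sets_shift_average[OF \<rho>] Z]
    by (rule expectation_pmf_cong)
  moreover have "measure (shift_average G ?p \<rho>) Z = measure_pmf.expectation ?p f"
    unfolding f_def by (rule measure_shift_average[OF \<rho> Z])
  moreover have "\<bar>f k\<bar> \<le> 1" for k
    using prob_space.prob_le_1[OF \<rho>(1)] by (simp add: f_def)
  ultimately show ?thesis
    using cesaro_walk_almost_stationary[of f 1 m G N] by (simp only: mult_1_right)
qed

lemma tendsto_on_cylinders_shift_average:
  fixes \<Lambda> :: "('i \<times> 'a \<Rightarrow> bool) measure"
  assumes L: "\<And>n. prob_space (L n)" "\<And>n. sets (L n) = sets (shift_space G)"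
    and \<Lambda>: "prob_space \<Lambda>" "sets \<Lambda> = sets (shift_space G)" and "set_pmf m \<subseteq> carrier G"
    and lim: "tendsto_on_cylinders (UNIV \<times> carrier G) L \<Lambda>"
  shows "tendsto_on_cylinders (UNIV \<times> carrier G) (\<lambda>n. shift_average G m (L n)) (shift_average G m \<Lambda>)"
  unfolding tendsto_on_cylinders_def
proof (intro allI impI)
  fix J :: "('i \<times> 'a) set" assume J: "finite J" "J \<subseteq> UNIV \<times> carrier G"
  let ?C = "cylinder (UNIV \<times> carrier G) J"
  let ?shifted = "\<lambda>g. coord_shift G g -` ?C \<inter> space (shift_space G)"
  have "(\<lambda>n. measure_pmf.expectation m (\<lambda>g. measure (L n) (?shifted g)))
      \<longlonglongrightarrow> measure_pmf.expectation m (\<lambda>g. measure \<Lambda> (?shifted g))"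
  proof (rule integral_dominated_convergence[where w="\<lambda>_. 1"])
    have "(\<lambda>n. measure (L n) (?shifted g)) \<longlonglongrightarrow> measure \<Lambda> (?shifted g)" if "g \<in> carrier G" for g
      unfolding coord_shift_vimage_cylinder[OF that J(2)]
      using J that by (intro tendsto_on_cylindersD[OF lim]) auto
    with assms(5) show "AE g in measure_pmf m. (\<lambda>n. measure (L n) (?shifted g)) \<longlonglongrightarrow> measure \<Lambda> (?shifted g)"
      by (auto simp: AE_measure_pmf_iff)
    show "AE g in measure_pmf m. norm (measure (L n) (?shifted g)) \<le> 1" for n
      using prob_space.prob_le_1[OF L(1)] by auto
  qed auto
  then show "(\<lambda>n. measure (shift_average G m (L n)) ?C) \<longlonglongrightarrow> measure (shift_average G m \<Lambda>) ?C"
    unfolding measure_shift_average[OF L sets_cylinder[OF J(1)]]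
      measure_shift_average[OF \<Lambda> sets_cylinder[OF J(1)]] .
qed

lemma shift_average_cesaro_walk_limit:
  fixes \<rho> :: "('i \<times> 'a \<Rightarrow> bool) measure"
  assumes m: "set_pmf m \<subseteq> carrier G" and \<rho>: "prob_space \<rho>" "sets \<rho> = sets (shift_space G)"
    and s: "strict_mono s" and \<Lambda>: "prob_space \<Lambda>" "sets \<Lambda> = sets (shift_space G)"
    and lim: "tendsto_on_cylinders (UNIV \<times> carrier G) (\<lambda>n. shift_average G (cesaro_walk G m (s n)) \<rho>) \<Lambda>"
  shows "shift_average G m \<Lambda> = \<Lambda>"
proof (rule bool_PiM_measure_eqI)
  show "finite_measure (shift_average G m \<Lambda>)" "finite_measure \<Lambda>"
    using \<Lambda>(1) prob_space_shift_average[OF \<Lambda>] by (simp_all add: prob_space_def)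
  fix J :: "('i \<times> 'a) set" assume J: "finite J" "J \<subseteq> UNIV \<times> carrier G"
  let ?C = "cylinder (UNIV \<times> carrier G) J" and ?L = "\<lambda>N. shift_average G (cesaro_walk G m N) \<rho>"
  let ?\<delta> = "\<lambda>N. measure (shift_average G m (?L N)) ?C - measure (?L N) ?C"
  have "(\<lambda>N. 2 / real (Suc N)) \<longlonglongrightarrow> 0"
    by (rule LIMSEQ_Suc[OF lim_const_over_n])
  moreover have "\<forall>\<^sub>F N in sequentially. norm (?\<delta> N) \<le> 2 / real (Suc N)"
    using shift_average_cesaro_walk_almost_invariant[OF \<rho> m sets_cylinder[OF J(1)]] by simp
  ultimately have "?\<delta> \<longlonglongrightarrow> 0"
    by (rule Lim_null_comparison[rotated])
  from tendsto_add[OF LIMSEQ_subseq_LIMSEQ[OF this s] tendsto_on_cylindersD[OF lim J]]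
  have "(\<lambda>n. measure (shift_average G m (?L (s n))) ?C) \<longlonglongrightarrow> measure \<Lambda> ?C"
    by (simp add: comp_def)
  moreover have "(\<lambda>n. measure (shift_average G m (?L (s n))) ?C) \<longlonglongrightarrow> measure (shift_average G m \<Lambda>) ?C"
    by (rule tendsto_on_cylindersD[OF tendsto_on_cylinders_shift_average[OF
            prob_space_shift_average[OF \<rho>] sets_shift_average[OF \<rho>] \<Lambda> m lim] J])
  ultimately show "measure (shift_average G m \<Lambda>) ?C = measure \<Lambda> ?C"
    by (rule LIMSEQ_unique[rotated])
qed (simp_all add: \<Lambda> sets_shift_average)

lemma exists_stationary_shift_limit:
  fixes \<rho> :: "('i::countable \<times> 'a \<Rightarrow> bool) measure"
  assumes "countable (carrier G)" and m: "set_pmf m \<subseteq> carrier G"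
    and \<rho>: "prob_space \<rho>" "sets \<rho> = sets (shift_space G)"
  obtains s \<Lambda> where "sets \<Lambda> = sets (shift_space G)" "stationary_action G \<Lambda> m (coord_shift G)"
    "tendsto_on_cylinders (UNIV \<times> carrier G) (\<lambda>n. shift_average G (cesaro_walk G m (s n)) \<rho>) \<Lambda>"
proof -
  let ?I = "UNIV \<times> carrier G :: ('i \<times> 'a) set"
  let ?L = "\<lambda>N. shift_average G (cesaro_walk G m N) \<rho>"
  have I: "countable ?I"
    using assms(1) by auto
  obtain s \<Lambda> where s: "strict_mono s" and \<Lambda>: "prob_space \<Lambda>" "sets \<Lambda> = sets (shift_space G)"
    and lim: "tendsto_on_cylinders ?I (\<lambda>n. ?L (s n)) \<Lambda>"
    by (rule bool_PiM_sequentially_compact[OF I prob_space_shift_average[OF \<rho>] sets_shift_average[OF \<rho>]])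
  show thesis
    by (rule that[OF \<Lambda>(2) stationary_action_coord_shift[OF \<Lambda> m
          shift_average_cesaro_walk_limit[OF m \<rho> s \<Lambda> lim]] lim])
qed

end

section \<open>Stationary joinings\<close>

definition itinerary :: "('g, 'b) monoid_scheme \<Rightarrow> ('g \<Rightarrow> 'x \<Rightarrow> 'x) \<Rightarrow> ('j \<Rightarrow> 'x set) \<Rightarrow> 'x \<Rightarrow> 'j \<times> 'g \<Rightarrow> bool" where
  "itinerary G a E y = (\<lambda>(j, h)\<in>UNIV \<times> carrier G. a h y \<in> E j)"

definition joint_itinerary ::
  "('g, 'b) monoid_scheme \<Rightarrow> ('n \<Rightarrow> 'g \<Rightarrow> 'x \<Rightarrow> 'x) \<Rightarrow> ('j \<Rightarrow> 'x set) \<Rightarrow> 'x \<Rightarrow> ('n \<times> 'j) \<times> 'g \<Rightarrow> bool" where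
  "joint_itinerary G a E y = (\<lambda>((n, j), h)\<in>UNIV \<times> carrier G. itinerary G (a n) E y (j, h))"

definition coord_slice :: "('g, 'b) monoid_scheme \<Rightarrow> 'n \<Rightarrow> (('n \<times> 'j) \<times> 'g \<Rightarrow> bool) \<Rightarrow> 'j \<times> 'g \<Rightarrow> bool" where
  "coord_slice G n x = (\<lambda>(j, h)\<in>UNIV \<times> carrier G. x ((n, j), h))"

lemma measurable_coord_slice [measurable]: "coord_slice G n \<in> shift_space G \<rightarrow>\<^sub>M shift_space G"
  unfolding coord_slice_def case_prod_beta by (rule measurable_restrict) measurable

lemma coord_slice_space: "coord_slice G n x \<in> space (shift_space G)"
  by (auto simp: coord_slice_def space_PiM)

lemma coord_slice_vimage_cylinder:
  assumes "J \<subseteq> UNIV \<times> carrier G"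
  shows "coord_slice G n -` cylinder (UNIV \<times> carrier G) J \<inter> space (shift_space G)
    = cylinder (UNIV \<times> carrier G) ((\<lambda>(j, h). ((n, j), h)) ` J)"
proof -
  have "coord_slice G n x (j, h) \<longleftrightarrow> x ((n, j), h)" if "(j, h) \<in> J" for x j h
    using that assms by (auto simp: coord_slice_def)
  then show ?thesis
    using coord_slice_space[of G n] by (fastforce simp: mem_cylinder_iff)
qed

lemma itinerary_space: "itinerary G a E y \<in> space (shift_space G)"
  by (auto simp: itinerary_def space_PiM)

lemma coord_slice_joint_itinerary: "coord_slice G n (joint_itinerary G a E y) = itinerary G (a n) E y"
  by (auto simp: coord_slice_def joint_itinerary_def itinerary_def restrict_def)

lemma (in group) coord_slice_coord_shift:
  assumes "g \<in> carrier G"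
  shows "coord_slice G n (coord_shift G g x) = coord_shift G g (coord_slice G n x)"
  using assms by (auto simp: coord_slice_def coord_shift_def restrict_def fun_eq_iff)

context stationary_action
begin

lemma measurable_itinerary:
  assumes [measurable]: "\<And>j. E j \<in> sets M"
  shows "itinerary G a E \<in> M \<rightarrow>\<^sub>M shift_space G"
  unfolding itinerary_def case_prod_beta by (rule measurable_restrict) auto

lemma AE_itinerary_one: "AE y in M. \<forall>j. itinerary G a E y (j, \<one>) \<longleftrightarrow> y \<in> E j"
  using AE_action_one by eventually_elim (simp add: itinerary_def)

lemma AE_itinerary_action:
  assumes "countable (carrier G)" "k \<in> carrier G"
  shows "AE y in M. itinerary G a E (a k y) = coord_shift G k (itinerary G a E y)"
proof -
  have "AE y in M. \<forall>h\<in>carrier G. a (h \<otimes> k) y = a h (a k y)"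
    unfolding AE_ball_countable[OF assms(1)] using AE_action_mult assms(2) by blast
  then show ?thesis
    by eventually_elim (use assms(2) in \<open>auto simp: itinerary_def coord_shift_def restrict_def fun_eq_iff\<close>)
qed

end

lemma measurable_joint_itinerary:
  assumes "\<And>n. stationary_action G M m (a n)" "\<And>j. E j \<in> sets M"
  shows "joint_itinerary G a E \<in> M \<rightarrow>\<^sub>M shift_space G"
proof -
  note [measurable] = stationary_action.measurable_itinerary[OF assms]
  show ?thesis
    unfolding joint_itinerary_def case_prod_beta by (rule measurable_restrict) measurable
qed

lemma measure_coord_slice_translate_joint_itinerary:
  assumes factors: "\<And>n. stationary_action G M m (a n)" and E: "\<And>j. E j \<in> sets M"
    and "countable (carrier G)" and k: "k \<in> carrier G" and W: "W \<in> sets (shift_space G)"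
  shows "measure (distr M (shift_space G) (joint_itinerary G a E))
      (coord_shift G k -` (coord_slice G n -` W \<inter> space (shift_space G)) \<inter> space (shift_space G))
    = measure M (a n k -` (itinerary G (a n) E -` W \<inter> space M) \<inter> space M)"
proof -
  interpret stationary_action G M m "a n" by (rule factors)
  note [measurable] = measurable_itinerary[OF E] measurable_joint_itinerary[OF factors E] W
  let ?Z = "coord_slice G n -` W \<inter> space (shift_space G)"
  have "measure (distr M (shift_space G) (joint_itinerary G a E)) (coord_shift G k -` ?Z \<inter> space (shift_space G))
      = measure M {y \<in> space M. coord_shift G k (itinerary G (a n) E y) \<in> W}"
    using measurable_space[OF measurable_joint_itinerary[OF factors E]] coord_shift_space[of G k]
    by (subst measure_distr)
      (auto intro!: arg_cong[where f="measure M"] simp: coord_slice_coord_shift[OF k] coord_slice_joint_itinerary)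
  also have "\<dots> = measure M {y \<in> space M. itinerary G (a n) E (a n k y) \<in> W}"
  proof (rule measure_eq_AE)
    show "AE y in M. y \<in> {y \<in> space M. coord_shift G k (itinerary G (a n) E y) \<in> W}
        \<longleftrightarrow> y \<in> {y \<in> space M. itinerary G (a n) E (a n k y) \<in> W}"
      using AE_itinerary_action[OF assms(3) k, of E] by eventually_elim simp
  qed (use k in measurable)
  also have "{y \<in> space M. itinerary G (a n) E (a n k y) \<in> W}
      = a n k -` (itinerary G (a n) E -` W \<inter> space M) \<inter> space M"
    using measurable_space[OF measurable_action[OF k]] by auto
  finally show ?thesis .
qed

lemma measure_coord_slice_shift_average_joint_itinerary:
  assumes factors: "\<And>n. stationary_action G M m (a n)" and E: "\<And>j. E j \<in> sets M"
    and "countable (carrier G)" and W: "W \<in> sets (shift_space G)"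
  shows "measure (shift_average G (cesaro_walk G m N) (distr M (shift_space G) (joint_itinerary G a E)))
      (coord_slice G n -` W \<inter> space (shift_space G)) = measure M (itinerary G (a n) E -` W \<inter> space M)"
proof -
  interpret stationary_action G M m "a n" by (rule factors)
  note [measurable] = measurable_itinerary[OF E] measurable_joint_itinerary[OF factors E] W
  let ?\<rho> = "distr M (shift_space G) (joint_itinerary G a E)"
  let ?Z = "coord_slice G n -` W \<inter> space (shift_space G)"
  have "measure (shift_average G (cesaro_walk G m N) ?\<rho>) ?Z = measure_pmf.expectation (cesaro_walk G m N)
      (\<lambda>k. measure ?\<rho> (coord_shift G k -` ?Z \<inter> space (shift_space G)))"
    by (rule measure_shift_average) (auto intro!: prob_space_distr)
  also have "\<dots> = measure_pmf.expectation (cesaro_walk G m N)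
      (\<lambda>k. measure M (a n k -` (itinerary G (a n) E -` W \<inter> space M) \<inter> space M))"
    using set_cesaro_walk_subset[OF set_pmf_subset_carrier]
    by (intro expectation_pmf_cong measure_coord_slice_translate_joint_itinerary[OF factors E assms(3) _ W]) auto
  also have "\<dots> = measure M (itinerary G (a n) E -` W \<inter> space M)"
    by (rule cesaro_walk_stationary) measurable
  finally show ?thesis .
qed

locale stationary_joining = stationary_action G \<Lambda> m "coord_shift G"
  for G :: "('g, 'b) monoid_scheme" (structure) and \<Lambda> :: "(('n::countable \<times> 'j::countable) \<times> 'g \<Rightarrow> bool) measure" and m +
  fixes M :: "'x measure" and a :: "'n \<Rightarrow> 'g \<Rightarrow> 'x \<Rightarrow> 'x" and E :: "'j \<Rightarrow> 'x set"
  assumes sets_joining [measurable_cong]: "sets \<Lambda> = sets (shift_space G)"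
    and factors: "\<And>n. stationary_action G M m (a n)"
    and sets_E [measurable]: "\<And>j. E j \<in> sets M"
    and distr_coord_slice:
      "\<And>n. distr \<Lambda> (shift_space G) (coord_slice G n) = distr M (shift_space G) (itinerary G (a n) E)"

lemma distr_coord_slice_limit:
  fixes a :: "'n \<Rightarrow> 'g \<Rightarrow> 'x \<Rightarrow> 'x" and E :: "'j \<Rightarrow> 'x set"
  assumes factors: "\<And>n. stationary_action G M m (a n)" and E: "\<And>j. E j \<in> sets M"
    and "countable (carrier G)" and \<Lambda>: "prob_space \<Lambda>" and sets_\<Lambda> [measurable_cong]: "sets \<Lambda> = sets (shift_space G)"
    and lim: "tendsto_on_cylinders (UNIV \<times> carrier G)
      (\<lambda>i. shift_average G (cesaro_walk G m (s i)) (distr M (shift_space G) (joint_itinerary G a E))) \<Lambda>"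
  shows "distr \<Lambda> (shift_space G) (coord_slice G n) = distr M (shift_space G) (itinerary G (a n) E)"
proof (rule bool_PiM_measure_eqI)
  interpret stationary_action G M m "a n" by (rule factors)
  interpret \<Lambda>: prob_space \<Lambda> by fact
  note [measurable] = measurable_itinerary[OF E]
  show "finite_measure (distr \<Lambda> (shift_space G) (coord_slice G n))"
    by (rule \<Lambda>.finite_measure_distr) simp
  show "finite_measure (distr M (shift_space G) (itinerary G (a n) E))"
    by (rule finite_measure_distr) simp
  fix J :: "('j \<times> 'g) set" assume J: "finite J" "J \<subseteq> UNIV \<times> carrier G"
  let ?\<rho> = "distr M (shift_space G) (joint_itinerary G a E)"
  let ?W = "cylinder (UNIV \<times> carrier G) J" and ?J = "(\<lambda>(j, h). ((n, j), h)) ` J"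
  note slice = coord_slice_vimage_cylinder[OF J(2), of n]
  have "measure (shift_average G (cesaro_walk G m N) ?\<rho>) (cylinder (UNIV \<times> carrier G) ?J)
      = measure M (itinerary G (a n) E -` ?W \<inter> space M)" for N
    unfolding slice[symmetric]
    by (rule measure_coord_slice_shift_average_joint_itinerary[OF factors E assms(3) sets_cylinder[OF J(1)]])
  moreover have "finite ?J" "?J \<subseteq> UNIV \<times> carrier G"
    using J by auto
  ultimately have "measure \<Lambda> (cylinder (UNIV \<times> carrier G) ?J) = measure M (itinerary G (a n) E -` ?W \<inter> space M)"
    by (intro LIMSEQ_unique[OF tendsto_on_cylindersD[OF lim, of ?J]]) simp_all
  then show "measure (distr \<Lambda> (shift_space G) (coord_slice G n)) ?W
      = measure (distr M (shift_space G) (itinerary G (a n) E)) ?W"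
    using sets_cylinder[OF J(1)] slice by (simp add: measure_distr sets_eq_imp_space_eq[OF sets_\<Lambda>])
qed simp_all

lemma exists_stationary_joining:
  fixes a :: "'n::countable \<Rightarrow> 'g \<Rightarrow> 'x \<Rightarrow> 'x" and E :: "'j::countable \<Rightarrow> 'x set"
  assumes "countable (carrier G)" and factors: "\<And>n. stationary_action G M m (a n)"
    and E: "\<And>j. E j \<in> sets M"
  obtains \<Lambda> where "stationary_joining G \<Lambda> m M a E"
proof -
  interpret factor: stationary_action G M m "a n" for n by (rule factors)
  let ?\<rho> = "distr M (shift_space G) (joint_itinerary G a E)"
  have \<rho>: "prob_space ?\<rho>" "sets ?\<rho> = sets (shift_space G)"
    by (auto intro: factor.prob_space_distr measurable_joint_itinerary[OF factors E])
  obtain s \<Lambda> where sets_\<Lambda>: "sets \<Lambda> = sets (shift_space G)"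
    and stationary: "stationary_action G \<Lambda> m (coord_shift G)"
    and lim: "tendsto_on_cylinders (UNIV \<times> carrier G) (\<lambda>i. shift_average G (cesaro_walk G m (s i)) ?\<rho>) \<Lambda>"
    by (rule factor.exists_stationary_shift_limit[OF assms(1) factor.set_pmf_subset_carrier \<rho>])
  interpret \<Lambda>: stationary_action G \<Lambda> m "coord_shift G" by (rule stationary)
  note distr_coord_slice_limit[OF factors E assms(1) \<Lambda>.prob_space_axioms sets_\<Lambda> lim]
  with sets_\<Lambda> factors E have "stationary_joining G \<Lambda> m M a E"
    by unfold_locales
  then show thesis
    by (rule that)
qed

context stationary_joining
begin

lemma space_joining: "space \<Lambda> = space (shift_space G)"
  by (rule sets_eq_imp_space_eq[OF sets_joining])

lemma measure_vimage_coord_slice: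
  assumes [measurable]: "W \<in> sets (shift_space G)"
  shows "measure \<Lambda> (coord_slice G n -` W \<inter> space \<Lambda>) = measure M (itinerary G (a n) E -` W \<inter> space M)"
proof -
  interpret factor: stationary_action G M m "a n" by (rule factors)
  note [measurable] = factor.measurable_itinerary[OF sets_E]
  have "measure \<Lambda> (coord_slice G n -` W \<inter> space \<Lambda>) = measure (distr \<Lambda> (shift_space G) (coord_slice G n)) W"
    by (rule measure_distr[symmetric]) measurable
  also have "\<dots> = measure M (itinerary G (a n) E -` W \<inter> space M)"
    unfolding distr_coord_slice by (rule measure_distr) measurable
  finally show ?thesis .
qed

end

section \<open>Weak containment of the factors of a joining\<close>

lemma measurable_map_list:
  fixes f :: "'j \<Rightarrow> 'a \<Rightarrow> 'c::countable"
  assumes "\<And>j. f j \<in> N \<rightarrow>\<^sub>M count_space UNIV"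
  shows "(\<lambda>w. map (\<lambda>j. f j w) js) \<in> N \<rightarrow>\<^sub>M count_space UNIV"
proof (induction js)
  case (Cons j js)
  have "(\<lambda>w. c # map (\<lambda>j. f j w) js) \<in> N \<rightarrow>\<^sub>M count_space UNIV" for c
    by (rule measurable_compose[OF Cons.IH]) simp
  from measurable_compose_countable[OF this assms] show ?case
    by simp
qed simp

definition overlap :: "'x measure \<Rightarrow> ('x \<Rightarrow> 'x) \<Rightarrow> 'x set \<Rightarrow> 'x set \<Rightarrow> real" where
  "overlap M T A B = measure M (A \<inter> (T -` B \<inter> space M))"

lemma overlap_conjugate:
  assumes iso: "mod0_iso M N \<theta> \<theta>'" and [measurable]: "T \<in> M \<rightarrow>\<^sub>M M" "A \<in> sets N" "B \<in> sets N"
  shows "overlap N (\<theta> \<circ> T \<circ> \<theta>') A B = measure M {x \<in> space M. \<theta> x \<in> A \<and> \<theta> (T x) \<in> B}"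
proof -
  note [measurable] = mod0_isoD(1,2)[OF iso]
  let ?C = "A \<inter> ((\<theta> \<circ> T \<circ> \<theta>') -` B \<inter> space N)"
  have C: "?C \<in> sets N"
    by measurable
  have "overlap N (\<theta> \<circ> T \<circ> \<theta>') A B = measure M (\<theta> -` ?C \<inter> space M)"
    unfolding overlap_def by (rule measure_vimage_mod0_iso[OF iso C, symmetric])
  also have "\<dots> = measure M {x \<in> space M. \<theta> x \<in> A \<and> \<theta> (T x) \<in> B}"
  proof (rule measure_eq_AE)
    show "AE x in M. x \<in> \<theta> -` ?C \<inter> space M \<longleftrightarrow> x \<in> {x \<in> space M. \<theta> x \<in> A \<and> \<theta> (T x) \<in> B}"
      using mod0_isoD(4)[OF iso] AE_space
      by eventually_elim (use measurable_space[OF mod0_isoD(1)[OF iso]] in auto)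
    show "\<theta> -` ?C \<inter> space M \<in> sets M"
      by (rule measurable_sets[OF mod0_isoD(1)[OF iso] C])
  qed measurable
  finally show ?thesis .
qed

context stationary_joining
begin

lemma std_nonatomic_lebesgue_joining:
  assumes "countable (carrier G)"
    and separating: "\<And>z. measure M {y \<in> space M. \<forall>j. y \<in> E j \<longleftrightarrow> z j} = 0"
  shows "std_nonatomic_lebesgue \<Lambda>"
proof (rule std_nonatomic_lebesgue_bool_PiM[OF _ prob_space_axioms sets_joining])
  fix n :: 'n
  interpret factor: stationary_action G M m "a n" by (rule factors)
  note [measurable] = factor.measurable_itinerary[OF sets_E]
  show "countable ((UNIV :: ('n \<times> 'j) set) \<times> carrier G)"
    using assms(1) by auto
  fix z :: "('n \<times> 'j) \<times> 'g \<Rightarrow> bool" assume z: "z \<in> space (shift_space G)"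
  define W where "W = {w \<in> space (shift_space G). \<forall>j. w (j, \<one>) \<longleftrightarrow> z ((n, j), \<one>)}"
  have [measurable]: "W \<in> sets (shift_space G)"
    unfolding W_def by measurable
  have "measure \<Lambda> {z} \<le> measure \<Lambda> (coord_slice G n -` W \<inter> space \<Lambda>)"
  proof (rule finite_measure_mono)
    have "coord_slice G n z (j, \<one>) \<longleftrightarrow> z ((n, j), \<one>)" for j
      by (simp add: coord_slice_def)
    then show "{z} \<subseteq> coord_slice G n -` W \<inter> space \<Lambda>"
      using z by (simp add: W_def space_joining coord_slice_space)
  qed measurable
  also have "\<dots> = measure M (itinerary G (a n) E -` W \<inter> space M)"
    by (rule measure_vimage_coord_slice) measurable
  also have "\<dots> \<le> measure M {y \<in> space M. \<forall>j. y \<in> E j \<longleftrightarrow> z ((n, j), \<one>)}"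
  proof (rule factor.finite_measure_mono_AE)
    show "AE y in M. y \<in> itinerary G (a n) E -` W \<inter> space M \<longrightarrow>
        y \<in> {y \<in> space M. \<forall>j. y \<in> E j \<longleftrightarrow> z ((n, j), \<one>)}"
      using factor.AE_itinerary_one[of E] by eventually_elim (auto simp: W_def)
  qed measurable
  finally show "measure \<Lambda> {z} = 0"
    by (simp add: separating measure_le_0_iff)
qed

lemma exists_matching_iso:
  assumes "std_nonatomic_lebesgue \<Lambda>" "std_nonatomic_lebesgue M"
  obtains \<Theta> \<Theta>' where "mod0_iso \<Lambda> M \<Theta> \<Theta>'"
    "AE x in \<Lambda>. \<forall>j\<in>set js. \<Theta> x \<in> E j \<longleftrightarrow> x ((n, j), \<one>)"
proof -
  interpret factor: stationary_action G M m "a n" by (rule factors)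
  note [measurable] = factor.measurable_itinerary[OF sets_E]
  define f where "f w = map (\<lambda>j. w (j, \<one>)) js" for w :: "'j \<times> 'g \<Rightarrow> bool"
  define q where "q y = map (\<lambda>j. y \<in> E j) js" for y
  have [measurable]: "f \<in> shift_space G \<rightarrow>\<^sub>M count_space UNIV"
    unfolding f_def by (rule measurable_map_list) measurable
  have [measurable]: "q \<in> M \<rightarrow>\<^sub>M count_space UNIV"
    unfolding q_def by (rule measurable_map_list) measurable
  have "distr \<Lambda> (count_space UNIV) (f \<circ> coord_slice G n)
      = distr (distr \<Lambda> (shift_space G) (coord_slice G n)) (count_space UNIV) f"
    by (rule distr_distr[symmetric]) measurable
  also have "\<dots> = distr M (count_space UNIV) (f \<circ> itinerary G (a n) E)"
    unfolding distr_coord_slice by (rule distr_distr) measurable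
  also have "\<dots> = distr M (count_space UNIV) q"
  proof (rule distr_cong_AE)
    show "AE y in M. (f \<circ> itinerary G (a n) E) y = q y"
      using factor.AE_itinerary_one[of E] by eventually_elim (simp add: f_def q_def)
  qed simp_all
  finally obtain \<Theta> \<Theta>' where iso: "mod0_iso \<Lambda> M \<Theta> \<Theta>'"
    and matched: "AE x in \<Lambda>. q (\<Theta> x) = (f \<circ> coord_slice G n) x"
    by (rule exists_mod0_iso_matching[OF assms, rotated 2]) measurable
  from matched have "AE x in \<Lambda>. \<forall>j\<in>set js. \<Theta> x \<in> E j \<longleftrightarrow> x ((n, j), \<one>)"
    by eventually_elim (simp add: f_def q_def coord_slice_def)
  with iso show thesis
    by (rule that)
qed

lemma measure_joining_coordinates:
  assumes g: "g \<in> carrier G"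
  shows "measure \<Lambda> {x \<in> space \<Lambda>. x ((n, j), \<one>) \<and> x ((n, l), g)} = overlap M (a n g) (E j) (E l)"
proof -
  interpret factor: stationary_action G M m "a n" by (rule factors)
  note [measurable] = factor.measurable_itinerary[OF sets_E] factor.measurable_action[OF g]
  define W where "W = cylinder (UNIV \<times> carrier G) {(j, \<one>), (l, g)}"
  have [measurable]: "W \<in> sets (shift_space G)"
    unfolding W_def by measurable
  have "coord_slice G n x \<in> W \<longleftrightarrow> x ((n, j), \<one>) \<and> x ((n, l), g)" for x
    using g by (simp add: W_def mem_cylinder_iff coord_slice_space) (simp add: coord_slice_def)
  then have "{x \<in> space \<Lambda>. x ((n, j), \<one>) \<and> x ((n, l), g)} = coord_slice G n -` W \<inter> space \<Lambda>"
    by auto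
  also have "measure \<Lambda> \<dots> = measure M (itinerary G (a n) E -` W \<inter> space M)"
    by (rule measure_vimage_coord_slice) measurable
  also have "\<dots> = overlap M (a n g) (E j) (E l)"
    unfolding overlap_def
  proof (rule measure_eq_AE)
    show "AE y in M. y \<in> itinerary G (a n) E -` W \<inter> space M \<longleftrightarrow> y \<in> E j \<inter> (a n g -` E l \<inter> space M)"
      using factor.AE_itinerary_one[of E] AE_space
    proof eventually_elim
      case (elim y)
      have "itinerary G (a n) E y \<in> W \<longleftrightarrow> itinerary G (a n) E y (j, \<one>) \<and> itinerary G (a n) E y (l, g)"
        by (simp add: W_def mem_cylinder_iff itinerary_space)
      moreover have "itinerary G (a n) E y (l, g) \<longleftrightarrow> a n g y \<in> E l"
        using g by (simp add: itinerary_def)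
      ultimately show ?case
        using elim by auto
    qed
  qed measurable
  finally show ?thesis .
qed

lemma overlap_matched:
  assumes "generating_pmf G m" and iso: "mod0_iso \<Lambda> M \<Theta> \<Theta>'"
    and matched: "AE x in \<Lambda>. \<forall>j\<in>J. \<Theta> x \<in> E j \<longleftrightarrow> x ((n, j), \<one>)"
    and jl: "j \<in> J" "l \<in> J" and g: "g \<in> carrier G"
  shows "overlap M (\<Theta> \<circ> coord_shift G g \<circ> \<Theta>') (E j) (E l) = overlap M (a n g) (E j) (E l)"
proof -
  note [measurable] = mod0_isoD(1)[OF iso] measurable_action[OF g]
  have "overlap M (\<Theta> \<circ> coord_shift G g \<circ> \<Theta>') (E j) (E l)
      = measure \<Lambda> {x \<in> space \<Lambda>. \<Theta> x \<in> E j \<and> \<Theta> (coord_shift G g x) \<in> E l}"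
    by (rule overlap_conjugate[OF iso]) measurable
  also have "\<dots> = measure \<Lambda> {x \<in> space \<Lambda>. x ((n, j), \<one>) \<and> x ((n, l), g)}"
  proof (rule measure_eq_AE)
    have shift_l: "coord_shift G g x ((n, l), \<one>) \<longleftrightarrow> x ((n, l), g)" for x
      using g by (simp add: coord_shift_def)
    show "AE x in \<Lambda>. x \<in> {x \<in> space \<Lambda>. \<Theta> x \<in> E j \<and> \<Theta> (coord_shift G g x) \<in> E l}
        \<longleftrightarrow> x \<in> {x \<in> space \<Lambda>. x ((n, j), \<one>) \<and> x ((n, l), g)}"
      using matched AE_nonsingular[OF nonsingular_action[OF assms(1) g] matched]
      by eventually_elim (use jl shift_l in auto)
  qed measurable
  also have "\<dots> = overlap M (a n g) (E j) (E l)"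
    by (rule measure_joining_coordinates[OF g])
  finally show ?thesis .
qed

lemma exists_conjugate_overlap:
  assumes "generating_pmf G m"
    and "std_nonatomic_lebesgue \<Lambda>" "std_nonatomic_lebesgue M" and iso: "mod0_iso \<Lambda> M \<theta> \<theta>'"
  shows "\<exists>T S. mod0_iso M M T S \<and> (\<forall>j\<in>set js. \<forall>l\<in>set js. \<forall>g\<in>carrier G.
    overlap M (conj_action T S (\<lambda>g. \<theta> \<circ> coord_shift G g \<circ> \<theta>') g) (E j) (E l) = overlap M (a n g) (E j) (E l))"
proof -
  obtain \<Theta> \<Theta>' where matching: "mod0_iso \<Lambda> M \<Theta> \<Theta>'"
    "AE x in \<Lambda>. \<forall>j\<in>set js. \<Theta> x \<in> E j \<longleftrightarrow> x ((n, j), \<one>)"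
    by (rule exists_matching_iso[OF assms(2,3)])
  define T where "T = \<Theta> \<circ> \<theta>'"
  define S where "S = \<theta> \<circ> \<Theta>'"
  have TS: "mod0_iso M M T S"
    unfolding T_def S_def by (rule mod0_iso_trans[OF mod0_iso_sym[OF iso] matching(1)])
  have matched: "AE x in \<Lambda>. \<forall>j\<in>set js. (T \<circ> \<theta>) x \<in> E j \<longleftrightarrow> x ((n, j), \<one>)"
    using matching(2) mod0_isoD(4)[OF iso] by eventually_elim (simp add: T_def)
  have "overlap M (T \<circ> \<theta> \<circ> coord_shift G g \<circ> (\<theta>' \<circ> S)) (E j) (E l) = overlap M (a n g) (E j) (E l)"
    if "j \<in> set js" "l \<in> set js" "g \<in> carrier G" for j l g
    by (rule overlap_matched[OF assms(1) mod0_iso_trans[OF iso TS] matched that])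
  with TS show ?thesis
    by (intro exI[of _ T] exI[of _ S]) (simp add: conj_action_def comp_assoc)
qed

end

section \<open>Dense families\<close>

definition measure_dense :: "'x measure \<Rightarrow> ('j \<Rightarrow> 'x set) \<Rightarrow> bool" where
  "measure_dense M E \<longleftrightarrow> (\<forall>A\<in>sets M. \<forall>\<epsilon>>0. \<exists>j. measure M (sym_diff A (E j)) < \<epsilon>)"

lemma exists_open_superset_measure_less:
  fixes M :: "'a::{second_countable_topology, complete_space} measure"
  assumes "finite_measure M" "sets M = sets borel" "A \<in> sets borel" and "0 < \<epsilon>"
  obtains U where "open U" "A \<subseteq> U" "measure M U < measure M A + \<epsilon>"
proof -
  interpret finite_measure M by fact
  have "emeasure M A < emeasure M A + ennreal \<epsilon>"
    using \<open>0 < \<epsilon>\<close> by (simp add: emeasure_eq_measure ennreal_less_iff flip: ennreal_plus)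
  then obtain U where "open U" "A \<subseteq> U" "emeasure M U < emeasure M A + ennreal \<epsilon>"
    using outer_regular[OF assms(2) _ assms(3)] by (auto simp: INF_less_iff)
  then show thesis
    using \<open>0 < \<epsilon>\<close> by (intro that) (simp_all add: emeasure_eq_measure ennreal_less_iff flip: ennreal_plus)
qed

lemma exists_finite_basis_union_measure_greater:
  fixes b :: "nat \<Rightarrow> 'a::topological_space set"
  assumes "topological_basis (range b)" "finite_measure M" "sets M = sets borel" "open U" "0 < \<epsilon>"
  obtains ks where "(\<Union>k\<in>set ks. b k) \<subseteq> U" "measure M U - \<epsilon> < measure M (\<Union>k\<in>set ks. b k)"
proof -
  interpret finite_measure M by fact
  define ks where "ks n = filter (\<lambda>k. b k \<subseteq> U) [0..<n]" for n
  let ?W = "\<lambda>n. \<Union>k\<in>set (ks n). b k"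
  have "open (b k)" for k
    using topological_basis_open[OF assms(1)] by blast
  then have "?W n \<in> sets M" for n
    by (auto simp: assms(3) intro!: borel_open)
  then have "(\<lambda>n. measure M (?W n)) \<longlonglongrightarrow> measure M (\<Union>n. ?W n)"
    by (intro finite_Lim_measure_incseq incseq_SucI) (auto simp: ks_def)
  also have "(\<Union>n. ?W n) = U"
  proof -
    have "\<exists>k. x \<in> b k \<and> b k \<subseteq> U" if "x \<in> U" for x
      using topological_basisE[OF assms(1,4) that] by (metis rangeE)
    then show ?thesis
      by (fastforce simp: ks_def)
  qed
  finally have "\<forall>\<^sub>F n in sequentially. measure M U - \<epsilon> < measure M (?W n)"
    using \<open>0 < \<epsilon>\<close> by (intro order_tendstoD) auto
  then obtain n where "measure M U - \<epsilon> < measure M (?W n)"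
    by (auto simp: eventually_sequentially)
  then show thesis
    by (rule that[rotated]) (auto simp: ks_def)
qed

lemma exists_finite_basis_union_sym_diff_less:
  fixes b :: "nat \<Rightarrow> 'a::polish_space set"
  assumes b: "topological_basis (range b)" and M: "finite_measure M" "sets M = sets borel"
    and A: "A \<in> sets borel" and "0 < \<epsilon>"
  shows "\<exists>ks. measure M (sym_diff A (\<Union>k\<in>set ks. b k)) < \<epsilon>"
proof -
  interpret finite_measure M by fact
  obtain U where U: "open U" "A \<subseteq> U" "measure M U < measure M A + \<epsilon> / 2"
    using exists_open_superset_measure_less[OF M A, of "\<epsilon> / 2"] \<open>0 < \<epsilon>\<close> by auto
  obtain ks where ks: "(\<Union>k\<in>set ks. b k) \<subseteq> U" "measure M U - \<epsilon> / 2 < measure M (\<Union>k\<in>set ks. b k)"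
    using exists_finite_basis_union_measure_greater[OF b M U(1), of "\<epsilon> / 2"] \<open>0 < \<epsilon>\<close> by auto
  let ?W = "\<Union>k\<in>set ks. b k"
  have "open ?W"
    using topological_basis_open[OF b] by auto
  then have sets: "A \<in> sets M" "U \<in> sets M" "?W \<in> sets M"
    using A U(1) M(2) by auto
  have "measure M (sym_diff A ?W) \<le> measure M ((U - A) \<union> (U - ?W))"
    using sets ks(1) U(2) by (intro finite_measure_mono) auto
  also have "\<dots> \<le> measure M (U - A) + measure M (U - ?W)"
    using sets by (intro measure_Un_le) auto
  also have "\<dots> < \<epsilon>"
    using sets ks U by (simp add: finite_measure_Diff)
  finally show ?thesis ..
qed

lemma exists_dense_open_sequence:
  obtains V :: "nat \<Rightarrow> 'a::polish_space set" where "\<And>j. open (V j)"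
    "\<And>M. finite_measure M \<Longrightarrow> sets M = sets borel \<Longrightarrow> measure_dense M V"
    "\<And>x y. x \<noteq> y \<Longrightarrow> \<exists>j. x \<in> V j \<and> y \<notin> V j"
proof -
  obtain \<B> :: "'a set set" where \<B>: "countable \<B>" "topological_basis \<B>"
    using ex_countable_basis by blast
  then have "\<B> \<noteq> {}"
    using topological_basisE[OF \<B>(2), of UNIV] by auto
  then obtain b :: "nat \<Rightarrow> 'a set" where b: "topological_basis (range b)"
    using \<B> range_from_nat_into by metis
  define V where "V j = (\<Union>k\<in>set (from_nat j). b k)" for j
  have V_to_nat: "V (to_nat ks) = (\<Union>k\<in>set ks. b k)" for ks
    by (simp add: V_def)
  show thesis
  proof (rule that)
    show "open (V j)" for j
      using topological_basis_open[OF b] by (auto simp: V_def)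
    show "measure_dense M V" if "finite_measure M" "sets M = sets borel" for M
      using exists_finite_basis_union_sym_diff_less[OF b that] that(2)
      unfolding measure_dense_def by (metis V_to_nat)
    fix x y :: 'a assume "x \<noteq> y"
    from t1_space[OF this] obtain U where "open U" "x \<in> U" "y \<notin> U"
      by blast
    then obtain k where "x \<in> b k" "y \<notin> b k"
      using topological_basisE[OF b] by (metis rangeE subsetD)
    then show "\<exists>j. x \<in> V j \<and> y \<notin> V j"
      by (intro exI[of _ "to_nat [k]"]) (simp add: V_to_nat)
  qed
qed

lemma measure_sym_diff_coding:
  assumes [measurable]: "e \<in> M \<rightarrow>\<^sub>M N" "d \<in> N \<rightarrow>\<^sub>M M" "A \<in> sets M" "V \<in> sets N"
    and decode: "AE x in M. d (e x) = x"
  shows "measure M (sym_diff A (e -` V \<inter> space M)) = measure (distr M N e) (sym_diff (d -` A \<inter> space N) V)"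
proof -
  have "measure M (sym_diff A (e -` V \<inter> space M)) = measure M (e -` sym_diff (d -` A \<inter> space N) V \<inter> space M)"
  proof (rule measure_eq_AE)
    show "AE x in M. x \<in> sym_diff A (e -` V \<inter> space M) \<longleftrightarrow> x \<in> e -` sym_diff (d -` A \<inter> space N) V \<inter> space M"
      using decode AE_space by eventually_elim (use measurable_space[OF assms(1)] in auto)
  qed measurable
  also have "\<dots> = measure (distr M N e) (sym_diff (d -` A \<inter> space N) V)"
    by (rule measure_distr[symmetric]) measurable
  finally show ?thesis .
qed

lemma std_nonatomic_lebesgue_dense_sets:
  assumes "std_nonatomic_lebesgue M"
  obtains E :: "nat \<Rightarrow> 'x set" where "\<And>j. E j \<in> sets M"
    "measure_dense M E"
    "\<And>z. measure M {x \<in> space M. \<forall>j. x \<in> E j \<longleftrightarrow> z j} = 0"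
proof -
  interpret prob_space M
    using assms by (simp add: std_nonatomic_lebesgue_def)
  obtain e :: "'x \<Rightarrow> real" and d where [measurable]: "e \<in> borel_measurable M" "d \<in> borel \<rightarrow>\<^sub>M M"
    and decode: "AE x in M. d (e x) = x" and fibres: "\<And>t. measure M (e -` {t} \<inter> space M) = 0"
    by (rule std_nonatomic_lebesgue_coding[OF assms]) blast
  obtain V :: "nat \<Rightarrow> real set" where open_V: "\<And>j. open (V j)"
    and dense_V: "\<And>N. finite_measure N \<Longrightarrow> sets N = sets borel \<Longrightarrow> measure_dense N V"
    and separating_V: "\<And>x y. x \<noteq> y \<Longrightarrow> \<exists>j. x \<in> V j \<and> y \<notin> V j"
    by (rule exists_dense_open_sequence) blast
  have [measurable]: "V j \<in> sets borel" for j
    using open_V by simp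
  define E where "E j = e -` V j \<inter> space M" for j
  have "measure_dense (distr M borel e) V"
    by (rule dense_V) (auto intro: finite_measure_distr)
  then have "\<exists>j. measure M (sym_diff A (E j)) < \<epsilon>" if "A \<in> sets M" "0 < \<epsilon>" for A \<epsilon>
    using that measurable_sets[of d borel M A]
    by (simp add: measure_dense_def E_def measure_sym_diff_coding[where e=e and d=d and N=borel] decode)
  then have dense: "measure_dense M E"
    by (simp add: measure_dense_def)
  have separating: "measure M {x \<in> space M. \<forall>j. x \<in> E j \<longleftrightarrow> z j} = 0" for z
  proof (cases "{x \<in> space M. \<forall>j. x \<in> E j \<longleftrightarrow> z j} = {}")
    case False
    then obtain y where y: "y \<in> space M" "\<And>j. y \<in> E j \<longleftrightarrow> z j"
      by auto
    have "e x = e y" if "x \<in> space M" "\<And>j. x \<in> E j \<longleftrightarrow> z j" for x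
      using that y separating_V[of "e x" "e y"] by (auto simp: E_def)
    then have "measure M {x \<in> space M. \<forall>j. x \<in> E j \<longleftrightarrow> z j} \<le> measure M (e -` {e y} \<inter> space M)"
      by (intro finite_measure_mono) auto
    then show ?thesis
      by (simp add: fibres measure_le_0_iff)
  qed (simp only: measure_empty)
  show thesis
    by (rule that[OF _ dense separating]) (simp add: E_def)
qed

lemma exists_pointwise_dense_sequence:
  fixes F :: "'a \<Rightarrow> 'k::countable \<Rightarrow> 'c::{metric_space, second_countable_topology}"
  assumes "S \<noteq> {}"
  obtains a :: "nat \<Rightarrow> 'a" where "\<And>n. a n \<in> S"
    "\<And>x. x \<in> S \<Longrightarrow> \<exists>r. \<forall>k. (\<lambda>n. F (a (r n)) k) \<longlonglongrightarrow> F x k"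
proof -
  obtain D where D: "countable D" "D \<subseteq> F ` S" "F ` S \<subseteq> closure D"
    using separable[of "F ` S"] by blast
  have "D \<noteq> {}"
    using D(3) assms by auto
  with D(1) have range_D: "range (from_nat_into D) = D"
    by (rule range_from_nat_into[rotated])
  then have "\<forall>n. \<exists>x. x \<in> S \<and> F x = from_nat_into D n"
    using D(2) by (metis imageE rangeI subsetD)
  then obtain a where a: "\<And>n. a n \<in> S" "\<And>n. F (a n) = from_nat_into D n"
    by metis
  show thesis
  proof (rule that[OF a(1)])
    fix x assume "x \<in> S"
    then have "F x \<in> closure D"
      using D(3) by auto
    then obtain f where f: "\<And>n. f n \<in> D" "f \<longlonglongrightarrow> F x"
      unfolding closure_sequential by blast
    have "\<forall>n. \<exists>i. F (a i) = f n"
      using f(1) a(2) range_D by (metis rangeE)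
    then obtain r where r: "\<And>n. F (a (r n)) = f n"
      by metis
    have "(\<lambda>n. f n k) \<longlonglongrightarrow> F x k" for k
      using continuous_on_tendsto_compose[OF continuous_on_product_coordinates f(2)] by simp
    then show "\<exists>r. \<forall>k. (\<lambda>n. F (a (r n)) k) \<longlonglongrightarrow> F x k"
      by (intro exI[of _ r]) (simp add: r)
  qed
qed

section \<open>Convergence in the very weak topology\<close>

lemma vw_eq_overlap:
  assumes "finite_measure M" and T: "nonsingular M T" and [measurable]: "S \<in> M \<rightarrow>\<^sub>M M"
    and inverse: "AE x in M. S (T x) = x" and [measurable]: "A \<in> sets M" "B \<in> sets M"
  shows "vw M T S A B = overlap M T A B"
proof -
  interpret finite_measure M by fact
  have [measurable]: "T \<in> M \<rightarrow>\<^sub>M M"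
    using T by (simp add: nonsingular_def)
  interpret T: finite_measure "distr M M T"
    by (rule finite_measure_distr) simp
  have "absolutely_continuous M (distr M M T)"
    using T by (auto simp: absolutely_continuous_def nonsingular_def null_sets_def emeasure_distr)
  then have "vw M T S A B = (\<integral>x. indicator A (S x) * indicator B x \<partial>distr M M T)"
    unfolding vw_def mult.assoc
    by (intro RN_deriv_integral[symmetric] T.sigma_finite_measure_axioms) measurable
  also have "\<dots> = (\<integral>x. indicator A (S (T x)) * indicator B (T x) \<partial>M)"
    by (rule integral_distr) measurable
  also have "\<dots> = (\<integral>x. indicator (A \<inter> (T -` B \<inter> space M)) x \<partial>M)"
  proof (rule integral_cong_AE)
    show "AE x in M. indicator A (S (T x)) * indicator B (T x)
        = (indicator (A \<inter> (T -` B \<inter> space M)) x :: real)"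
      using inverse AE_space by eventually_elim (auto simp: indicator_def)
  qed measurable
  also have "\<dots> = overlap M T A B"
    by (simp add: overlap_def Int_absorb2 le_infI2)
  finally show ?thesis .
qed

context finite_measure
begin

lemma abs_measure_diff_le:
  assumes "X \<in> sets M" "Y \<in> sets M" "U \<in> sets M" "V \<in> sets M" and "sym_diff X Y \<subseteq> U \<union> V"
  shows "\<bar>measure M X - measure M Y\<bar> \<le> measure M U + measure M V"
proof -
  have "measure M X \<le> measure M (Y \<union> (U \<union> V))" "measure M Y \<le> measure M (X \<union> (U \<union> V))"
    using assms by (auto intro!: finite_measure_mono)
  moreover have "measure M (Y \<union> (U \<union> V)) \<le> measure M Y + measure M (U \<union> V)"
    "measure M (X \<union> (U \<union> V)) \<le> measure M X + measure M (U \<union> V)"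
    "measure M (U \<union> V) \<le> measure M U + measure M V"
    using assms by (auto intro!: measure_Un_le)
  ultimately show ?thesis
    by linarith
qed

lemma abs_overlap_diff_le:
  assumes T: "T \<in> M \<rightarrow>\<^sub>M M" and sets: "A \<in> sets M" "A' \<in> sets M" "B \<in> sets M" "B' \<in> sets M"
    and bound: "\<And>D. D \<in> sets M \<Longrightarrow> measure M (T -` D \<inter> space M) \<le> c * measure M D"
  shows "\<bar>overlap M T A B - overlap M T A' B'\<bar> \<le> measure M (sym_diff A A') + c * measure M (sym_diff B B')"
proof -
  have "\<bar>overlap M T A B - overlap M T A' B'\<bar>
      \<le> measure M (sym_diff A A') + measure M (T -` sym_diff B B' \<inter> space M)"
    unfolding overlap_def using T sets by (intro abs_measure_diff_le) auto
  also have "measure M (T -` sym_diff B B' \<inter> space M) \<le> c * measure M (sym_diff B B')"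
    using sets by (intro bound) auto
  finally show ?thesis
    by simp
qed

lemma tendsto_overlap_of_dense:
  assumes "0 \<le> c" and T: "T \<in> M \<rightarrow>\<^sub>M M" "\<And>D. D \<in> sets M \<Longrightarrow> measure M (T -` D \<inter> space M) \<le> c * measure M D"
    and T': "\<And>n. T' n \<in> M \<rightarrow>\<^sub>M M"
      "\<And>n D. D \<in> sets M \<Longrightarrow> measure M (T' n -` D \<inter> space M) \<le> c * measure M D"
    and E: "\<And>j. E j \<in> sets M" and dense: "measure_dense M E"
    and lim: "\<And>j l. ((\<lambda>n. overlap M (T' n) (E j) (E l)) \<longlongrightarrow> overlap M T (E j) (E l)) F"
    and A: "A \<in> sets M" and B: "B \<in> sets M"
  shows "((\<lambda>n. overlap M (T' n) A B) \<longlongrightarrow> overlap M T A B) F"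
proof (rule tendstoI)
  fix \<epsilon> :: real assume "0 < \<epsilon>"
  define \<delta> where "\<delta> = \<epsilon> / 3 / (1 + c)"
  have "0 < \<delta>"
    using \<open>0 \<le> c\<close> \<open>0 < \<epsilon>\<close> by (simp add: \<delta>_def)
  have "\<delta> + c * \<delta> = (1 + c) * \<delta>"
    by (simp add: algebra_simps)
  also have "\<dots> = \<epsilon> / 3"
    unfolding \<delta>_def using \<open>0 \<le> c\<close> by (subst times_divide_eq_right, subst nonzero_mult_div_cancel_left) simp_all
  finally have \<delta>: "\<delta> + c * \<delta> = \<epsilon> / 3" .
  obtain j l where jl: "measure M (sym_diff A (E j)) < \<delta>" "measure M (sym_diff B (E l)) < \<delta>"
    using dense A B \<open>0 < \<delta>\<close> unfolding measure_dense_def by blast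
  have close: "\<bar>overlap M R A B - overlap M R (E j) (E l)\<bar> < \<epsilon> / 3"
    if "R \<in> M \<rightarrow>\<^sub>M M" "\<And>D. D \<in> sets M \<Longrightarrow> measure M (R -` D \<inter> space M) \<le> c * measure M D" for R
    using abs_overlap_diff_le[OF that(1) A E B E that(2), of j l] jl \<delta>
      mult_left_mono[OF less_imp_le[OF jl(2)] \<open>0 \<le> c\<close>] by linarith
  have "\<forall>\<^sub>F n in F. dist (overlap M (T' n) (E j) (E l)) (overlap M T (E j) (E l)) < \<epsilon> / 3"
    using lim \<open>0 < \<epsilon>\<close> by (intro tendstoD) auto
  then show "\<forall>\<^sub>F n in F. dist (overlap M (T' n) A B) (overlap M T A B) < \<epsilon>"
  proof eventually_elim
    case (elim n)
    then show ?case
      using close[OF T] close[OF T', of n] unfolding dist_real_def by linarith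
  qed
qed

end

lemma limitin_topology_generated_byI:
  assumes "l \<in> \<Union>\<S>" and "\<And>U. U \<in> \<S> \<Longrightarrow> l \<in> U \<Longrightarrow> \<forall>\<^sub>F x in F. f x \<in> U"
  shows "limitin (topology_generated_by \<S>) f l F"
  unfolding limitin_def
proof (intro conjI allI impI)
  show "l \<in> topspace (topology_generated_by \<S>)"
    using assms(1) by simp
  fix U assume "openin (topology_generated_by \<S>) U \<and> l \<in> U"
  then have "generate_topology_on \<S> U" "l \<in> U"
    by (auto simp: openin_topology_generated_by_iff)
  then show "\<forall>\<^sub>F x in F. f x \<in> U"
  proof induction
    case (Int U V)
    then show ?case
      by (auto intro: eventually_conj)
  next
    case (UN K)
    then obtain X where X: "X \<in> K" "l \<in> X"
      by blast
    from UN.IH[OF this] show ?case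
      by (rule eventually_mono) (use X in blast)
  qed (use assms(2) in auto)
qed

lemma limitin_vw_topI:
  assumes "\<And>A B. A \<in> sets M \<Longrightarrow> B \<in> sets M \<Longrightarrow> ((\<lambda>n. vw M (T n) (S n) A B) \<longlongrightarrow> vw M T' S' A B) F"
  shows "limitin (vw_top M) (\<lambda>n. (T n, S n)) (T', S') F"
  unfolding vw_top_def
proof (rule limitin_topology_generated_byI)
  show "(T', S') \<in> \<Union>{{p. vw M (fst p) (snd p) A B \<in> U} | A B U. A \<in> sets M \<and> B \<in> sets M \<and> open U}"
    using sets.empty_sets[of M] open_UNIV by blast
qed (use topological_tendstoD[OF assms] in auto)

lemma limitin_A_topI:
  assumes "carrier G \<noteq> {}" "a \<in> A_mu G \<mu> M" "\<And>n. b n \<in> A_mu G \<mu> M"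
    and "\<And>g A B. g \<in> carrier G \<Longrightarrow> A \<in> sets M \<Longrightarrow> B \<in> sets M \<Longrightarrow>
      ((\<lambda>n. vw M (b n g) (b n (inv\<^bsub>G\<^esub> g)) A B) \<longlongrightarrow> vw M (a g) (a (inv\<^bsub>G\<^esub> g)) A B) F"
  shows "limitin (A_top G \<mu> M) b a F"
  unfolding A_top_def limitin_subtopology
proof (intro conjI limitin_topology_generated_byI)
  let ?\<S> = "{{a. (a g, a (inv\<^bsub>G\<^esub> g)) \<in> V} | g V. g \<in> carrier G \<and> openin (vw_top M) V}"
  have lim: "limitin (vw_top M) (\<lambda>n. (b n g, b n (inv\<^bsub>G\<^esub> g))) (a g, a (inv\<^bsub>G\<^esub> g)) F" if "g \<in> carrier G" for g
    by (rule limitin_vw_topI) (rule assms(4)[OF that])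
  obtain g where g: "g \<in> carrier G"
    using assms(1) by blast
  have "a \<in> {a. (a g, a (inv\<^bsub>G\<^esub> g)) \<in> topspace (vw_top M)}"
    using limitin_topspace[OF lim[OF g]] by simp
  with g show "a \<in> \<Union>?\<S>"
    by blast
  show "\<forall>\<^sub>F n in F. b n \<in> U" if "U \<in> ?\<S>" "a \<in> U" for U
    using that limitinD[OF lim] by auto
qed (use assms(2,3) in auto)

lemma limitin_imp_in_closure_of:
  assumes "limitin X f l F" "\<And>n. f n \<in> S" "F \<noteq> bot"
  shows "l \<in> X closure_of S"
  unfolding in_closure_of
proof (intro conjI allI impI)
  show "l \<in> topspace X"
    by (rule limitin_topspace[OF assms(1)])
  fix U assume "l \<in> U \<and> openin X U"
  then have "\<forall>\<^sub>F n in F. f n \<in> U"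
    using limitinD[OF assms(1)] by blast
  then obtain n where "f n \<in> U"
    using eventually_happens'[OF assms(3)] by blast
  with assms(2) show "\<exists>y. y \<in> S \<and> y \<in> U"
    by blast
qed

section \<open>A stationary action with dense orbit\<close>

lemma (in stationary_action) vw_action:
  assumes "generating_pmf G m"
    and "g \<in> carrier G" "A \<in> sets M" "B \<in> sets M"
  shows "vw M (a g) (a (inv g)) A B = overlap M (a g) A B"
  using assms
  by (intro vw_eq_overlap finite_measure_axioms nonsingular_action AE_action_inv measurable_action) auto

lemma in_A_top_closure_of_dense_overlap:
  assumes generating: "generating_pmf G m"
    and \<alpha>: "stationary_action G M m \<alpha>" and b: "\<And>n. stationary_action G M m (b n)" "\<And>n. b n \<in> S"
    and E: "\<And>j. E j \<in> sets M" and dense: "measure_dense M E"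
    and lim: "\<And>g j l. g \<in> carrier G \<Longrightarrow>
      (\<lambda>n. overlap M (b n g) (E j) (E l)) \<longlonglongrightarrow> overlap M (\<alpha> g) (E j) (E l)"
  shows "\<alpha> \<in> A_top G (pmf m) M closure_of S"
proof (rule limitin_imp_in_closure_of[OF limitin_A_topI])
  interpret stationary_action G M m \<alpha> by (rule \<alpha>)
  show "carrier G \<noteq> {}"
    using one_closed by blast
  show "\<alpha> \<in> A_mu G (pmf m) M" "b n \<in> A_mu G (pmf m) M" for n
    using A_mu_iff_stationary_action[OF group_axioms prob_space_axioms generating] \<alpha> b(1) by auto
  fix g A B assume g: "g \<in> carrier G" and A: "A \<in> sets M" and B: "B \<in> sets M"
  then obtain i where i: "g \<in> set_pmf (random_walk G m i)"
    using exists_random_walk_mem[OF generating] by blast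
  define c where "c = 1 / pmf (random_walk G m i) g"
  have bound: "measure M (\<beta> g -` D \<inter> space M) \<le> c * measure M D"
    if "stationary_action G M m \<beta>" "D \<in> sets M" for \<beta> D
    using stationary_action.measure_vimage_action_le[OF that(1) i that(2)] by (simp add: c_def)
  have "(\<lambda>n. overlap M (b n g) A B) \<longlonglongrightarrow> overlap M (\<alpha> g) A B"
  proof (rule tendsto_overlap_of_dense[OF _ _ bound[OF \<alpha>] _ bound[OF b(1)] E dense lim[OF g] A B])
    show "b n g \<in> M \<rightarrow>\<^sub>M M" for n
      by (rule stationary_action.measurable_action[OF b(1) g])
  qed (simp_all add: c_def measurable_action[OF g])
  then show "(\<lambda>n. vw M (b n g) (b n (inv\<^bsub>G\<^esub> g)) A B) \<longlonglongrightarrow> vw M (\<alpha> g) (\<alpha> (inv\<^bsub>G\<^esub> g)) A B"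
    by (simp add: vw_action[OF generating g A B] stationary_action.vw_action[OF b(1) generating g A B])
qed (use b(2) in auto)

lemma in_A_top_closure_of_joining_orbit:
  fixes a :: "'n::countable \<Rightarrow> 'g \<Rightarrow> 'x \<Rightarrow> 'x" and E :: "nat \<Rightarrow> 'x set"
  assumes joining: "stationary_joining G \<Lambda> m M a E" and iso: "mod0_iso \<Lambda> M \<theta> \<theta>'"
    and generating: "generating_pmf G m"
    and std: "std_nonatomic_lebesgue \<Lambda>" "std_nonatomic_lebesgue M"
    and dense: "measure_dense M E"
    and \<alpha>: "stationary_action G M m \<alpha>"
    and lim: "\<And>g j l. g \<in> carrier G \<Longrightarrow>
      (\<lambda>i. overlap M (a (r i) g) (E j) (E l)) \<longlonglongrightarrow> overlap M (\<alpha> g) (E j) (E l)"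
  shows "\<alpha> \<in> A_top G (pmf m) M closure_of
    {conj_action T S (\<lambda>g. \<theta> \<circ> coord_shift G g \<circ> \<theta>') | T S. aut M T S}"
proof -
  interpret stationary_joining G \<Lambda> m M a E by (rule joining)
  define b where "b = (\<lambda>g. \<theta> \<circ> coord_shift G g \<circ> \<theta>')"
  have b: "stationary_action G M m b"
    unfolding b_def by (rule stationary_action_conjugate[OF generating iso])
  have "\<exists>T S. mod0_iso M M T S \<and> (\<forall>j<i. \<forall>l<i. \<forall>g\<in>carrier G.
      overlap M (conj_action T S b g) (E j) (E l) = overlap M (a (r i) g) (E j) (E l))" for i
    using exists_conjugate_overlap[OF generating std iso, of "[0..<i]" "r i"] by (simp add: b_def Ball_def)
  then obtain T S where TS: "\<And>i. mod0_iso M M (T i) (S i)"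
    and matched: "\<And>i j l g. j < i \<Longrightarrow> l < i \<Longrightarrow> g \<in> carrier G \<Longrightarrow>
      overlap M (conj_action (T i) (S i) b g) (E j) (E l) = overlap M (a (r i) g) (E j) (E l)"
    by metis
  have "\<alpha> \<in> A_top G (pmf m) M closure_of {conj_action T S b | T S. aut M T S}"
  proof (rule in_A_top_closure_of_dense_overlap[OF generating \<alpha> _ _ sets_E dense])
    show "stationary_action G M m (conj_action (T i) (S i) b)" for i
      unfolding conj_action_def
      by (rule stationary_action.stationary_action_conjugate[OF b generating TS])
    show "conj_action (T i) (S i) b \<in> {conj_action T S b | T S. aut M T S}" for i
      using aut_mod0_iso[OF TS] by blast
    fix g j l assume g: "g \<in> carrier G"
    have "\<forall>\<^sub>F i in sequentially. overlap M (a (r i) g) (E j) (E l)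
        = overlap M (conj_action (T i) (S i) b g) (E j) (E l)"
      using eventually_gt_at_top[of "max j l"] by eventually_elim (simp add: matched g)
    then show "(\<lambda>i. overlap M (conj_action (T i) (S i) b g) (E j) (E l)) \<longlonglongrightarrow> overlap M (\<alpha> g) (E j) (E l)"
      by (rule Lim_transform_eventually[OF lim[OF g]])
  qed
  then show ?thesis
    by (simp only: b_def)
qed

lemma exists_overlap_dense_sequence:
  fixes E :: "'j::countable \<Rightarrow> 'x set"
  assumes "countable (carrier G)" "S \<noteq> {}"
  obtains a :: "nat \<Rightarrow> 'g \<Rightarrow> 'x \<Rightarrow> 'x" where "\<And>n. a n \<in> S"
    "\<And>\<alpha>. \<alpha> \<in> S \<Longrightarrow> \<exists>r. \<forall>g\<in>carrier G. \<forall>j l.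
      (\<lambda>n. overlap M (a (r n) g) (E j) (E l)) \<longlonglongrightarrow> overlap M (\<alpha> g) (E j) (E l)"
proof -
  define F where "F = (\<lambda>a (j :: 'j, l :: 'j, i). overlap M (a (from_nat_into (carrier G) i)) (E j) (E l))"
  have F: "F \<alpha> (j, l, to_nat_on (carrier G) g) = overlap M (\<alpha> g) (E j) (E l)" if "g \<in> carrier G" for \<alpha> j l g
    using that assms(1) by (simp add: F_def)
  obtain a :: "nat \<Rightarrow> 'g \<Rightarrow> 'x \<Rightarrow> 'x" where a: "\<And>n. a n \<in> S"
    and dense: "\<And>\<alpha>. \<alpha> \<in> S \<Longrightarrow> \<exists>r. \<forall>k. (\<lambda>n. F (a (r n)) k) \<longlonglongrightarrow> F \<alpha> k"
    by (rule exists_pointwise_dense_sequence[OF assms(2), of F]) blast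
  show thesis
  proof (rule that[OF a])
    fix \<alpha> assume "\<alpha> \<in> S"
    then obtain r where r: "(\<lambda>n. F (a (r n)) k) \<longlonglongrightarrow> F \<alpha> k" for k
      using dense by blast
    have "(\<lambda>n. overlap M (a (r n) g) (E j) (E l)) \<longlonglongrightarrow> overlap M (\<alpha> g) (E j) (E l)"
      if "g \<in> carrier G" for g j l
      using r[of "(j, l, to_nat_on (carrier G) g)"] by (simp only: F[OF that])
    then show "\<exists>r. \<forall>g\<in>carrier G. \<forall>j l.
        (\<lambda>n. overlap M (a (r n) g) (E j) (E l)) \<longlonglongrightarrow> overlap M (\<alpha> g) (E j) (E l)"
      by blast
  qed
qed

lemma exists_dense_orbit:
  fixes G :: "('g, 'b) monoid_scheme" and M :: "'x measure"
  assumes "group G" "countable (carrier G)" and generating: "generating_pmf G m"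
    and std: "std_nonatomic_lebesgue M"
  obtains b where "stationary_action G M m b"
    "\<And>\<alpha>. stationary_action G M m \<alpha> \<Longrightarrow>
      \<alpha> \<in> A_top G (pmf m) M closure_of {conj_action T S b | T S. aut M T S}"
proof -
  have "prob_space M"
    using std by (simp add: std_nonatomic_lebesgue_def)
  then have nonempty: "{a. stationary_action G M m a} \<noteq> {}"
    using stationary_action_trivial[OF assms(1) _ set_pmf_subset_of_generating[OF generating]] by auto
  obtain E :: "nat \<Rightarrow> 'x set" where E: "\<And>j. E j \<in> sets M"
    and dense: "measure_dense M E"
    and separating: "\<And>z. measure M {x \<in> space M. \<forall>j. x \<in> E j \<longleftrightarrow> z j} = 0"
    by (rule std_nonatomic_lebesgue_dense_sets[OF std]) blast
  obtain a :: "nat \<Rightarrow> 'g \<Rightarrow> 'x \<Rightarrow> 'x" where a: "\<And>n. a n \<in> {a. stationary_action G M m a}"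
    and a_dense: "\<And>\<alpha>. \<alpha> \<in> {a. stationary_action G M m a} \<Longrightarrow> \<exists>r. \<forall>g\<in>carrier G. \<forall>j l.
      (\<lambda>n. overlap M (a (r n) g) (E j) (E l)) \<longlonglongrightarrow> overlap M (\<alpha> g) (E j) (E l)"
    by (rule exists_overlap_dense_sequence[OF assms(2) nonempty, of M E]) blast
  have "stationary_action G M m (a n)" for n
    using a by simp
  then obtain \<Lambda> where joining: "stationary_joining G \<Lambda> m M a E"
    by (rule exists_stationary_joining[OF assms(2) _ E])
  then interpret joining: stationary_joining G \<Lambda> m M a E .
  have std_\<Lambda>: "std_nonatomic_lebesgue \<Lambda>"
    by (rule joining.std_nonatomic_lebesgue_joining[OF assms(2) separating])
  obtain \<theta> \<theta>' where iso: "mod0_iso \<Lambda> M \<theta> \<theta>'"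
    using joining.exists_matching_iso[OF std_\<Lambda> std] by blast
  show thesis
  proof (rule that)
    show "stationary_action G M m (\<lambda>g. \<theta> \<circ> coord_shift G g \<circ> \<theta>')"
      by (rule joining.stationary_action_conjugate[OF generating iso])
    fix \<alpha> assume \<alpha>: "stationary_action G M m \<alpha>"
    then obtain r where r: "\<And>g j l. g \<in> carrier G \<Longrightarrow>
        (\<lambda>n. overlap M (a (r n) g) (E j) (E l)) \<longlonglongrightarrow> overlap M (\<alpha> g) (E j) (E l)"
      using a_dense by blast
    show "\<alpha> \<in> A_top G (pmf m) M closure_of
        {conj_action T S (\<lambda>g. \<theta> \<circ> coord_shift G g \<circ> \<theta>') | T S. aut M T S}"
      by (rule in_A_top_closure_of_joining_orbit[OF joining iso generating std_\<Lambda> std dense \<alpha> r])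
  qed
qed

theorem theorem1p8:
  fixes G :: "('g, 'b) monoid_scheme" and \<mu> :: "'g \<Rightarrow> real" and M :: "'x measure"
  assumes "group G"
    and "countable (carrier G)"
    and "\<forall>g. 0 \<le> \<mu> g"
    and "\<forall>g. g \<notin> carrier G \<longrightarrow> \<mu> g = 0"
    and "(\<mu> has_sum 1) (carrier G)"
    and "semigroup_generated G {g \<in> carrier G. 0 < \<mu> g} = carrier G"
    and "std_nonatomic_lebesgue M"
  shows "\<exists>a \<in> A_mu G \<mu> M.
           A_mu G \<mu> M \<subseteq> A_top G \<mu> M closure_of {conj_action T S a | T S. aut M T S}"
proof -
  obtain m where m: "pmf m = \<mu>" "set_pmf m = {g \<in> carrier G. 0 < \<mu> g}"
    using exists_pmf_of_has_sum[of \<mu> "carrier G"] assms(3-5) by blast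
  have generating: "generating_pmf G m"
    by (simp only: generating_pmf_def m(2) assms(6))
  have "prob_space M"
    using assms(7) by (simp add: std_nonatomic_lebesgue_def)
  then have A_mu_iff: "a \<in> A_mu G \<mu> M \<longleftrightarrow> stationary_action G M m a" for a
    using A_mu_iff_stationary_action[OF assms(1) _ generating] by (simp only: m(1))
  obtain b where "stationary_action G M m b"
    "\<And>\<alpha>. stationary_action G M m \<alpha> \<Longrightarrow>
      \<alpha> \<in> A_top G (pmf m) M closure_of {conj_action T S b | T S. aut M T S}"
    by (rule exists_dense_orbit[OF assms(1,2) generating assms(7)]) blast
  then show ?thesis
    unfolding m(1) using A_mu_iff by blast
qed

end
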